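(* Let $\xi>0$, suppose $p=n^{\xi}$, and let $X^{(1)},\dots,X^{(n)}$ be an i.i.d. sample from a nonparanormal distribution on $\mathbb{R}^p$ with marginal distribution functions $F_1,\dots,F_p$, normalized so that $\mu_j=0$ and $\sigma_j=1$ for all $j$, with $f_j=\Phi^{-1}\circ F_j$. Let $\tilde f$ be the Winsorized estimator with truncation parameter $\delta_n=\frac{1}{4n^{1/4}\sqrt{\pi\log n}}$. Let $M>1+\frac1\xi$ and $$C(M,\xi)=\frac{48}{\sqrt{\pi\xi}}\left(\sqrt{2M}-1\right)(M+2).$$ Then there are positive constants $c_3,c_4$ (not depending on $n$) such that, as $n\to\infty$, $$\mathbb{P}\left(\max_{j,k}\left|S_n(\tilde f)_{jk}-S_n(f)_{jk}\right|>C(M,\xi)\sqrt{\frac{\log p\,\log^2 n}{n^{1/2}}}\right)\le o(1)+c_3\exp\left(-c_4C^2(M,\xi)\right).$$ Hence $$\max_{j,k}\left|S_n(\tilde f)_{jk}-S_n(f)_{jk}\right|=O_P\left(\sqrt{\frac{\log p\,\log^2 n}{n^{1/2}}}\right).$$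
   Context: $\Phi$ is the standard normal distribution function. A random vector $X=(X_1,\dots,X_p)$ is nonparanormal, $X\sim NPN(\mu,\Sigma,f)$, if there are functions $f_1,\dots,f_p$ with $f(X)=(f_1(X_1),\dots,f_p(X_p))\sim N(\mu,\Sigma)$; the $f_j$ are monotone, and are normalized to preserve means and variances, so that $f_j(x)=\mu_j+\sigma_j\Phi^{-1}(F_j(x))$, where $F_j$ is the distribution function of $X_j$ and $\sigma_j^2=\Sigma_{jj}$. Standing assumption: $\mu_j=0$, $\sigma_j=1$ for all $j$, so $f_j=\Phi^{-1}\circ F_j$. Given the sample $X^{(i)}=(X^{(i)}_1,\dots,X^{(i)}_p)$, let $\hat F_j(t)=\frac1n\sum_{i=1}^n \mathbf 1\{X^{(i)}_j\le t\}$ and define the truncated (Winsorized) estimator $\tilde F_j(x)=\delta_n$ if $\hat F_j(x)<\delta_n$; $\tilde F_j(x)=\hat F_j(x)$ if $\delta_n\le\hat F_j(x)\le 1-\delta_n$; and $\tilde F_j(x)=1-\delta_n$ if $\hat F_j(x)>1-\delta_n$. The Winsorized estimator of the transformation is $\tilde f_j(x)=\Phi^{-1}(\tilde F_j(x))$. For a vector of functions $g=(g_1,\dots,g_p)$, write $g(X^{(i)})=(g_1(X^{(i)}_1),\dots,g_p(X^{(i)}_p))^T$, $\mu_n(g)=\frac1n\sum_{i=1}^n g(X^{(i)})$, and $S_n(g)=\frac1n\sum_{i=1}^n (g(X^{(i)})-\mu_n(g))(g(X^{(i)})-\mu_n(g))^T$. $Y_n=O_P(a_n)$ means $Y_n/a_n$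 is bounded in probability. *)

theory Defs
  imports "HOL-Probability.Probability"
begin

text \<open>
  The dimension varies with the sample size, so a vector in \<open>\<real>\<^sup>p\<close> is a function
  \<open>nat \<Rightarrow> real\<close> read on the indices \<open>{..<p}\<close>, and a Borel law on \<open>\<real>\<^sup>p\<close> is a measure on
  \<open>\<Pi>\<^sub>M j\<in>{..<p}. borel\<close>.
\<close>

abbreviation borel_vec :: "nat \<Rightarrow> (nat \<Rightarrow> real) measure" where
  "borel_vec p \<equiv> (\<Pi>\<^sub>M j\<in>{..<p}. borel)"

definition Phi :: "real \<Rightarrow> real" where
  "Phi = cdf std_normal_distribution"

text \<open>Meaningful on the range \<open>{0<..<1}\<close> of \<open>Phi\<close> only; outside it the value is one
  unspecified real.\<close>

definition Phi_inv :: "real \<Rightarrow> real" where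
  "Phi_inv = inv Phi"

text \<open>
  \<open>N(\<mu>, V)\<close> is the law all of whose linear functionals \<open>\<Sum>j. a j * x j\<close> are normal with mean
  \<open>\<Sum>j. a j * \<mu> j\<close> and variance \<open>a\<^sup>T V a\<close>. A functional of variance 0 is almost surely constant,
  so singular \<open>V\<close> are covered.
\<close>

definition multivariate_normal ::
    "nat \<Rightarrow> (nat \<Rightarrow> real) \<Rightarrow> (nat \<Rightarrow> nat \<Rightarrow> real) \<Rightarrow> (nat \<Rightarrow> real) measure \<Rightarrow> bool" where
  "multivariate_normal p \<mu> V N \<longleftrightarrow>
     prob_space N \<and> sets N = sets (borel_vec p) \<and>
     (\<forall>j<p. \<forall>k<p. V j k = V k j) \<and>
     (\<forall>a :: nat \<Rightarrow> real.
        let m = (\<Sum>j<p. a j * \<mu> j); v = (\<Sum>j<p. \<Sum>k<p. a j * a k * V j k) in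
        0 \<le> v \<and>
        (if v = 0 then (AE x in N. (\<Sum>j<p. a j * x j) = m)
         else distr N borel (\<lambda>x. \<Sum>j<p. a j * x j) = density lborel (normal_density m (sqrt v))))"

definition marginal_cdf :: "(nat \<Rightarrow> real) measure \<Rightarrow> nat \<Rightarrow> real \<Rightarrow> real" where
  "marginal_cdf P j = cdf (distr P borel (\<lambda>x. x j))"

text \<open>
  The law \<open>P\<close> is \<open>NPN(\<mu>, V, f)\<close>. The last clause is the normalization that the \<open>f j\<close> preserve
  means and variances. Monotonicity is required where \<open>0 < F\<^sub>j < 1\<close>: if the support of the
  \<open>j\<close>-th coordinate is bounded on one side, \<open>\<mu>\<^sub>j + \<sigma>\<^sub>j \<Phi>\<^sup>-\<^sup>1(F\<^sub>j)\<close> is infinite beyond it, and the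
  values of the real function \<open>f j\<close> on that null set carry no information.
\<close>

definition nonparanormal ::
    "nat \<Rightarrow> (nat \<Rightarrow> real) \<Rightarrow> (nat \<Rightarrow> nat \<Rightarrow> real) \<Rightarrow> (nat \<Rightarrow> real \<Rightarrow> real) \<Rightarrow>
     (nat \<Rightarrow> real) measure \<Rightarrow> bool" where
  "nonparanormal p \<mu> V f P \<longleftrightarrow>
     prob_space P \<and> sets P = sets (borel_vec p) \<and>
     (\<forall>j<p. f j \<in> borel_measurable borel \<and>
        mono_on {x. 0 < marginal_cdf P j x \<and> marginal_cdf P j x < 1} (f j)) \<and>
     multivariate_normal p \<mu> V (distr P (borel_vec p) (\<lambda>x. \<lambda>j\<in>{..<p}. f j (x j))) \<and>
     (\<forall>j<p. integrable P (\<lambda>x. (x j)\<^sup>2) \<and>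
        (\<integral>x. x j \<partial>P) = \<mu> j \<and> (\<integral>x. (x j - \<mu> j)\<^sup>2 \<partial>P) = V j j)"

definition iid_sample ::
    "nat \<Rightarrow> nat \<Rightarrow> (nat \<Rightarrow> real) measure \<Rightarrow> 'a measure \<Rightarrow> (nat \<Rightarrow> 'a \<Rightarrow> nat \<Rightarrow> real) \<Rightarrow> bool" where
  "iid_sample n p P \<Omega> X \<longleftrightarrow>
     prob_space \<Omega> \<and>
     prob_space.indep_vars \<Omega> (\<lambda>_. borel_vec p) X {..<n} \<and>
     (\<forall>i<n. distr \<Omega> (borel_vec p) (X i) = P)"

text \<open>In the following, \<open>x i j\<close> is the \<open>j\<close>-th coordinate of the \<open>i\<close>-th observation.\<close>

definition emp_cdf :: "nat \<Rightarrow> (nat \<Rightarrow> nat \<Rightarrow> real) \<Rightarrow> nat \<Rightarrow> real \<Rightarrow> real" where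
  "emp_cdf n x j t = (1 / real n) * (\<Sum>i<n. if x i j \<le> t then 1 else 0)"

definition trunc_param :: "nat \<Rightarrow> real" where
  "trunc_param n = 1 / (4 * real n powr (1/4) * sqrt (pi * ln (real n)))"

definition winsor_cdf :: "nat \<Rightarrow> (nat \<Rightarrow> nat \<Rightarrow> real) \<Rightarrow> nat \<Rightarrow> real \<Rightarrow> real" where
  "winsor_cdf n x j t =
     (if emp_cdf n x j t < trunc_param n then trunc_param n
      else if emp_cdf n x j t \<le> 1 - trunc_param n then emp_cdf n x j t
      else 1 - trunc_param n)"

definition winsor_transform :: "nat \<Rightarrow> (nat \<Rightarrow> nat \<Rightarrow> real) \<Rightarrow> nat \<Rightarrow> real \<Rightarrow> real" where
  "winsor_transform n x j t = Phi_inv (winsor_cdf n x j t)"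

definition sample_mean ::
    "nat \<Rightarrow> (nat \<Rightarrow> nat \<Rightarrow> real) \<Rightarrow> (nat \<Rightarrow> real \<Rightarrow> real) \<Rightarrow> nat \<Rightarrow> real" where
  "sample_mean n x g j = (1 / real n) * (\<Sum>i<n. g j (x i j))"

definition sample_cov ::
    "nat \<Rightarrow> (nat \<Rightarrow> nat \<Rightarrow> real) \<Rightarrow> (nat \<Rightarrow> real \<Rightarrow> real) \<Rightarrow> nat \<Rightarrow> nat \<Rightarrow> real" where
  "sample_cov n x g j k =
     (1 / real n) * (\<Sum>i<n. (g j (x i j) - sample_mean n x g j) * (g k (x i k) - sample_mean n x g k))"

definition max_cov_error ::
    "nat \<Rightarrow> nat \<Rightarrow> (nat \<Rightarrow> nat \<Rightarrow> real) \<Rightarrow> (nat \<Rightarrow> real \<Rightarrow> real) \<Rightarrow> real" where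
  "max_cov_error n p x f =
     Max {\<bar>sample_cov n x (winsor_transform n x) j k - sample_cov n x f j k\<bar> | j k. j < p \<and> k < p}"

definition C_const :: "real \<Rightarrow> real \<Rightarrow> real" where
  "C_const M \<xi> = 48 / sqrt (pi * \<xi>) * (sqrt (2 * M) - 1) * (M + 2)"

definition cov_rate :: "nat \<Rightarrow> nat \<Rightarrow> real" where
  "cov_rate n p = sqrt (ln (real p) * (ln (real n))\<^sup>2 / real n powr (1/2))"

text \<open>\<open>Y\<^sub>n = O\<^sub>P(a\<^sub>n)\<close>, where \<open>Y\<^sub>n\<close> is defined on its own probability space \<open>\<Omega>\<^sub>n\<close>.\<close>

definition bigo_prob ::
    "(nat \<Rightarrow> 'a measure) \<Rightarrow> (nat \<Rightarrow> 'a \<Rightarrow> real) \<Rightarrow> (nat \<Rightarrow> real) \<Rightarrow> bool" where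
  "bigo_prob \<Omega> Y a \<longleftrightarrow>
     (\<forall>\<epsilon>>0. \<exists>K>0. \<forall>\<^sub>F n in sequentially.
        measure (\<Omega> n) {\<omega> \<in> space (\<Omega> n). \<bar>Y n \<omega> / a n\<bar> > K} \<le> \<epsilon>)"

end

theory Submission
  imports Defs "HOL-Real_Asymp.Real_Asymp"
begin

text \<open>
  The scores \<open>f\<^sub>j(X\<^sub>j)\<close> are standard normal, and up to ties the empirical distribution function
  at an observation depends on the scores only. By Hoeffding's inequality on a grid of quantiles,
  \<open>sup \<bar>F\<^sub>n - \<Phi>\<bar>\<close> is of order \<open>\<surd>(log n / n)\<close> for all \<open>p = n\<^sup>\<xi>\<close> coordinates at once, and all scores
  are bounded by \<open>L = c \<surd>(log n)\<close>. Let \<open>T = \<Phi>\<^sup>-\<^sup>1(1 - \<delta>\<^sub>n)\<close>. On \<open>[-T, T]\<close> the derivative of \<open>\<Phi>\<close> is at least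
  \<open>\<phi>(T) \<ge> T \<delta>\<^sub>n\<close>, so the Winsorized score differs from the score clipped to \<open>[-T, T]\<close> by
  \<open>\<surd>(log n / n) / (T \<delta>\<^sub>n)\<close>; at most a fraction of about \<open>2 \<delta>\<^sub>n\<close> of the scores is clipped,
  each by at most \<open>L\<close>. As \<open>T\<close> is of order \<open>\<surd>(log n)\<close> as well, the covariances change by
  \<open>O(log n / n\<^sup>1\<^sup>/\<^sup>4)\<close>, which is \<open>o\<close> of the claimed rate \<open>log\<^sup>3\<^sup>/\<^sup>2 n / n\<^sup>1\<^sup>/\<^sup>4\<close>. Hence the probability in
  question tends to 0 for every constant in front of the rate, and the summand \<open>c\<^sub>3 exp(-c\<^sub>4 C\<^sup>2)\<close>
  can be spent freely.
\<close>

section \<open>The standard normal distribution function\<close>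

interpretation std_normal: real_distribution std_normal_distribution
  by (rule real_dist_normal_dist)

lemma continuous_on_normal_density: "continuous_on S (normal_density \<mu> \<sigma>)"
  unfolding normal_density_def[abs_def] divide_inverse by (intro continuous_intros)

lemma std_normal_density_neg: "std_normal_density (- x) = std_normal_density x"
  by (simp add: std_normal_density_def)

lemma std_normal_density_antimono:
  assumes "\<bar>x\<bar> \<le> \<bar>y\<bar>"
  shows "std_normal_density y \<le> std_normal_density x"
proof -
  have "x\<^sup>2 \<le> y\<^sup>2" using assms abs_le_square_iff by blast
  then show ?thesis by (simp add: std_normal_density_def divide_right_mono)
qed

lemma has_real_derivative_std_normal_density:
  "(std_normal_density has_real_derivative - x * std_normal_density x) (at x)"
proof -
  have "((\<lambda>x::real. exp (- x\<^sup>2 / 2)) has_real_derivative - x * exp (- x\<^sup>2 / 2)) (at x)"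
    by (auto intro!: derivative_eq_intros simp: power2_eq_square)
  from DERIV_cmult[OF this, of "1 / sqrt (2 * pi)"] show ?thesis
    unfolding std_normal_density_def[abs_def] by (simp add: mult_ac)
qed

text \<open>Turns the measure-theoretic distribution function into an integral over a compact
  interval, to which the fundamental theorem of calculus applies.\<close>

lemma Phi_eq_integral:
  assumes "a \<le> x"
  shows "Phi x = Phi a + integral {a..x} std_normal_density"
proof (cases "a = x")
  case False
  have int: "set_integrable lborel A std_normal_density" if "A \<in> sets borel" for A
    unfolding set_integrable_def using that by (intro integrable_mult_indicator) auto
  have "Phi x - Phi a = measure std_normal_distribution {a<..x}"
    unfolding Phi_def using False assms by (intro std_normal.cdf_diff_eq) auto
  also have "\<dots> = (\<integral>y. indicator {a<..x} y \<partial>std_normal_distribution)"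
    by simp
  also have "\<dots> = (\<integral>y. std_normal_density y * indicator {a<..x} y \<partial>lborel)"
    by (subst integral_density) auto
  also have "\<dots> = (LINT y:{a<..x}|lborel. std_normal_density y)"
    by (simp add: set_lebesgue_integral_def mult.commute)
  also have "\<dots> = integral {a<..x} std_normal_density"
    by (rule set_borel_integral_eq_integral) (rule int, simp)
  also have "\<dots> = integral {a..x} std_normal_density"
    by (rule integral_subset_negligible) (auto intro: negligible_subset[of "{a}"])
  finally show ?thesis by simp
qed simp

lemma has_real_derivative_Phi: "(Phi has_real_derivative std_normal_density x) (at x)"
proof -
  \<comment> \<open>With base point \<open>x - 1\<close> the integral formula holds on a full
    neighbourhood of \<open>x\<close>, so the derivative is two-sided.\<close>
  have "((\<lambda>y. integral {x - 1..y} std_normal_density) has_real_derivative std_normal_density x)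
      (at x within {x - 1..x + 1})"
    by (rule integral_has_real_derivative) (auto intro: continuous_on_normal_density)
  then have "((\<lambda>y. Phi (x - 1) + integral {x - 1..y} std_normal_density)
      has_real_derivative 0 + std_normal_density x) (at x within {x - 1..x + 1})"
    by (intro DERIV_add DERIV_const)
  then have "((\<lambda>y. Phi (x - 1) + integral {x - 1..y} std_normal_density)
      has_real_derivative std_normal_density x) (at x)"
    by (simp add: at_within_Icc_at)
  then show ?thesis
    by (rule has_field_derivative_transform_within_open[where S = "{x - 1<..<x + 1}"])
       (auto simp: Phi_eq_integral[of "x - 1", symmetric])
qed

section \<open>Order, limits, symmetry and inversion of \<open>Phi\<close>; Gaussian tail
  estimates\<close>

lemma Phi_less_iff: "Phi x < Phi y \<longleftrightarrow> x < y"
proof -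
  have *: "Phi x < Phi y" if "x < y" for x y
    using that by (rule DERIV_pos_imp_increasing) (meson has_real_derivative_Phi normal_density_pos zero_less_one)
  show ?thesis
    using *[of x y] *[of y x] by (cases x y rule: linorder_cases) auto
qed

lemma Phi_le_iff: "Phi x \<le> Phi y \<longleftrightarrow> x \<le> y"
  using Phi_less_iff[of y x] by linarith

lemma mono_Phi: "mono Phi"
  by (simp add: mono_def Phi_le_iff)

lemma Phi_at_top: "(Phi \<longlongrightarrow> 1) at_top"
  unfolding Phi_def by (rule std_normal.cdf_lim_at_top_prob)

lemma Phi_at_bot: "(Phi \<longlongrightarrow> 0) at_bot"
  unfolding Phi_def by (rule std_normal.cdf_lim_at_bot)

text \<open>As the density is even, \<open>Phi y + Phi (- y)\<close> has derivative 0; its limit at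
  infinity is 1.\<close>

lemma Phi_minus: "Phi (- x) = 1 - Phi x"
proof -
  define g where "g y = Phi y + Phi (- y)" for y
  have "(g has_real_derivative 0) (at y)" for y
    unfolding g_def
    by (auto intro!: derivative_eq_intros has_real_derivative_Phi
          DERIV_chain2[where f = Phi, OF has_real_derivative_Phi] simp: std_normal_density_neg)
  then have const: "g y = g x" for y
    using DERIV_isconst_all by blast
  have "(g \<longlongrightarrow> 1 + 0) at_top"
    unfolding g_def
    by (intro tendsto_add Phi_at_top filterlim_compose[OF Phi_at_bot] filterlim_uminus_at_bot_at_top)
  moreover have "(g \<longlongrightarrow> g x) at_top"
    by (rule tendsto_eventually) (use const in auto)
  ultimately have "g x = 1"
    using tendsto_unique[of at_top g "g x" 1] by simp
  then show ?thesis by (simp add: g_def)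
qed

lemma Phi_pos: "0 < Phi x"
proof -
  have "0 \<le> Phi (x - 1)" unfolding Phi_def by (rule std_normal.cdf_nonneg)
  also have "\<dots> < Phi x" by (simp add: Phi_less_iff)
  finally show ?thesis .
qed

lemma Phi_less_1: "Phi x < 1"
  using Phi_pos[of "- x"] by (simp add: Phi_minus)

text \<open>The intermediate value theorem puts \<open>u\<close> in the range of \<open>Phi\<close>,
  where \<open>inv\<close> is a right inverse.\<close>

lemma Phi_Phi_inv:
  assumes "0 < u" "u < 1"
  shows "Phi (Phi_inv u) = u"
proof -
  obtain a where a: "Phi a < u"
    using order_tendstoD(2)[OF Phi_at_bot assms(1)] by (auto simp: eventually_at_bot_linorder)
  obtain b where b: "u < Phi b"
    using order_tendstoD(1)[OF Phi_at_top assms(2)] by (auto simp: eventually_at_top_linorder)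
  have "a \<le> b" using a b Phi_less_iff[of a b] by simp
  then have "\<exists>x. a \<le> x \<and> x \<le> b \<and> Phi x = u"
    using a b by (intro IVT) (auto intro: DERIV_isCont has_real_derivative_Phi)
  then have "u \<in> range Phi" by auto
  then show ?thesis unfolding Phi_inv_def by (rule f_inv_into_f)
qed

text \<open>The difference \<open>h\<close> of the two sides has derivative
  \<open>- std_normal_density y / y^2\<close>, hence decreases, and it tends to 0 at infinity; so it
  is nonnegative.\<close>

lemma Mills_bound:
  assumes "0 < t"
  shows "1 - Phi t \<le> std_normal_density t / t"
proof -
  define h where "h y = std_normal_density y / y - (1 - Phi y)" for y
  have der: "(h has_real_derivative - std_normal_density y / y\<^sup>2) (at y)" if "0 < y" for y
    unfolding h_def using that
    by (auto intro!: derivative_eq_intros has_real_derivative_Phi has_real_derivative_std_normal_density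
          simp: field_simps power2_eq_square)
  have dec: "h y \<le> h t" if "t \<le> y" for y
  proof (rule DERIV_nonpos_imp_nonincreasing[OF that])
    fix z assume "t \<le> z"
    with assms have "0 < z" by simp
    then show "\<exists>d. (h has_real_derivative d) (at z) \<and> d \<le> 0"
      by (intro exI[of _ "- std_normal_density z / z\<^sup>2"] conjI der) auto
  qed
  have "((\<lambda>y::real. std_normal_density y / y) \<longlongrightarrow> 0) at_top"
    unfolding std_normal_density_def by real_asymp
  then have "(h \<longlongrightarrow> 0 - (1 - 1)) at_top"
    unfolding h_def by (intro tendsto_diff tendsto_const Phi_at_top)
  then have "0 \<le> h t"
    using dec by (intro tendsto_upperbound[of h 0 at_top]) (auto simp: eventually_at_top_linorder)
  then show ?thesis by (simp add: h_def)
qed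

text \<open>Keeps only the mass of the tail between \<open>t\<close> and \<open>t + 1\<close>, where
  the density is at least its value at \<open>t + 1\<close>. Crude, but enough for the order of the
  truncation point.\<close>

lemma Phi_tail_lower_bound:
  assumes "0 \<le> t"
  shows "std_normal_density (t + 1) \<le> 1 - Phi t"
proof -
  obtain z where z: "t < z" "z < t + 1" "Phi (t + 1) - Phi t = (t + 1 - t) * std_normal_density z"
    using MVT2[of t "t + 1" Phi std_normal_density] has_real_derivative_Phi by auto
  have "std_normal_density (t + 1) \<le> std_normal_density z"
    using z assms by (intro std_normal_density_antimono) auto
  then show ?thesis using z(3) Phi_less_1[of "t + 1"] by simp
qed

text \<open>Mean value theorem: on \<open>[-T, T]\<close> the density is smallest at the endpoints.
  Closeness of probabilities is thereby converted into closeness of scores.\<close>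

lemma Phi_expanding:
  assumes "\<bar>x\<bar> \<le> T" "\<bar>y\<bar> \<le> T"
  shows "std_normal_density T * \<bar>x - y\<bar> \<le> \<bar>Phi x - Phi y\<bar>"
proof -
  have *: "std_normal_density T * (y - x) \<le> Phi y - Phi x" if "x < y" "\<bar>x\<bar> \<le> T" "\<bar>y\<bar> \<le> T" for x y
  proof -
    obtain z where z: "x < z" "z < y" "Phi y - Phi x = (y - x) * std_normal_density z"
      using MVT2[of x y Phi std_normal_density] has_real_derivative_Phi \<open>x < y\<close> by auto
    have "std_normal_density T \<le> std_normal_density z"
      using z that by (intro std_normal_density_antimono) auto
    then show ?thesis using z that by (simp add: mult.commute mult_left_mono)
  qed
  show ?thesis
    using *[of x y] *[of y x] assms by (cases x y rule: linorder_cases) auto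
qed

section \<open>Empirical means and covariances\<close>

definition mean :: "nat \<Rightarrow> (nat \<Rightarrow> real) \<Rightarrow> real" where
  "mean n a = (1 / real n) * (\<Sum>i<n. a i)"

definition covar :: "nat \<Rightarrow> (nat \<Rightarrow> real) \<Rightarrow> (nat \<Rightarrow> real) \<Rightarrow> real" where
  "covar n a b = mean n (\<lambda>i. (a i - mean n a) * (b i - mean n b))"

lemma sample_cov_eq_covar:
  "sample_cov n x g j k = covar n (\<lambda>i. g j (x i j)) (\<lambda>i. g k (x i k))"
  by (simp add: sample_cov_def sample_mean_def covar_def mean_def)

lemma mean_add: "mean n (\<lambda>i. a i + b i) = mean n a + mean n b"
  by (simp add: mean_def sum.distrib distrib_left)

lemma mean_diff: "mean n (\<lambda>i. a i - b i) = mean n a - mean n b"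
  by (simp add: mean_def sum_subtractf right_diff_distrib)

lemma mean_cmult: "mean n (\<lambda>i. c * a i) = c * mean n a"
  by (simp add: mean_def sum_distrib_left mult.left_commute)

lemma mean_const: "0 < n \<Longrightarrow> mean n (\<lambda>i. c) = c"
  by (simp add: mean_def)

lemma mean_mono: "(\<And>i. i < n \<Longrightarrow> a i \<le> b i) \<Longrightarrow> mean n a \<le> mean n b"
  by (auto simp: mean_def intro!: divide_right_mono sum_mono)

lemma abs_mean_le: "\<bar>mean n a\<bar> \<le> mean n (\<lambda>i. \<bar>a i\<bar>)"
  unfolding mean_def abs_mult by (intro mult_mono sum_abs) auto

lemma covar_commute: "covar n a b = covar n b a"
  by (simp add: covar_def mult.commute)

text \<open>Deviations from the mean average to 0, so centring one factor is enough; in this form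
  the covariance is visibly linear in the other factor.\<close>

lemma covar_eq_mean:
  assumes "0 < n"
  shows "covar n a b = mean n (\<lambda>i. (a i - mean n a) * b i)"
proof -
  have "covar n a b = mean n (\<lambda>i. (a i - mean n a) * b i - mean n b * (a i - mean n a))"
    by (simp add: covar_def algebra_simps)
  also have "\<dots> = mean n (\<lambda>i. (a i - mean n a) * b i) - mean n b * (mean n a - mean n a)"
    using assms by (simp only: mean_diff mean_cmult mean_const)
  finally show ?thesis by simp
qed

text \<open>Telescoping through \<open>covar n w z'\<close>. Each summand pairs a bounded sequence
  with a sequence of score errors, the shape that \<open>abs_covar_le\<close> handles.\<close>

lemma covar_diff:
  assumes "0 < n"
  shows "covar n w w' - covar n z z' =
    covar n w (\<lambda>i. w' i - z' i) + covar n z' (\<lambda>i. w i - z i)"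
proof -
  have r: "covar n a (\<lambda>i. b i - c i) = covar n a b - covar n a c" for a b c
    using assms by (simp add: covar_eq_mean right_diff_distrib mean_diff)
  show ?thesis by (simp add: r covar_commute[of n z'])
qed

text \<open>A sequence bounded by \<open>A\<close> deviates from its mean by at most
  \<open>2 * A\<close>. The other factor has to be small only on average, so a few clipped scores
  may be far off.\<close>

lemma abs_covar_le:
  assumes "0 < n" "\<And>i. i < n \<Longrightarrow> \<bar>a i\<bar> \<le> A" "mean n (\<lambda>i. \<bar>b i\<bar>) \<le> m"
  shows "\<bar>covar n a b\<bar> \<le> 2 * A * m"
proof -
  have "0 \<le> A" using assms(2)[of 0] \<open>0 < n\<close> by linarith
  have "\<bar>mean n a\<bar> \<le> mean n (\<lambda>i. \<bar>a i\<bar>)" by (rule abs_mean_le)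
  also have "\<dots> \<le> mean n (\<lambda>i. A)" by (rule mean_mono) (rule assms(2))
  finally have *: "\<bar>a i - mean n a\<bar> \<le> 2 * A" if "i < n" for i
    using assms(2)[OF that] \<open>0 < n\<close> by (simp add: mean_const)
  have "\<bar>covar n a b\<bar> \<le> mean n (\<lambda>i. \<bar>(a i - mean n a) * b i\<bar>)"
    using \<open>0 < n\<close> by (simp only: covar_eq_mean abs_mean_le)
  also have "\<dots> \<le> mean n (\<lambda>i. 2 * A * \<bar>b i\<bar>)"
    by (rule mean_mono) (simp add: abs_mult * mult_right_mono)
  also have "\<dots> \<le> 2 * A * m"
    using assms(3) \<open>0 \<le> A\<close> by (simp add: mean_cmult mult_left_mono)
  finally show ?thesis .
qed

section \<open>Distribution functions and Winsorized scores of a fixed sample\<close>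

text \<open>Two-sided bounds for \<open><\<close> and \<open>\<le>\<close> separately make ties in the data harmless.\<close>

lemma empirical_Phi_from_grid:
  fixes z :: "nat \<Rightarrow> real"
  assumes "0 < n" "0 \<le> \<epsilon>"
    and grid: "\<And>k. k \<in> {1..<n} \<Longrightarrow>
      \<bar>mean n (\<lambda>l. of_bool (z l \<le> Phi_inv (real k / real n))) - real k / real n\<bar> \<le> \<epsilon>"
  shows "mean n (\<lambda>l. of_bool (z l \<le> t)) \<le> Phi t + (\<epsilon> + 1 / real n)" (is ?upper)
    and "Phi t - (\<epsilon> + 1 / real n) \<le> mean n (\<lambda>l. of_bool (z l < t))" (is ?lower)
proof -
  \<comment> \<open>The least index with \<open>Phi t \<le> k / n\<close>. The levels
    \<open>k / n\<close> and \<open>(k - 1) / n\<close> enclose \<open>Phi t\<close>, which accounts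
    for the loss \<open>1 / n\<close>.\<close>
  define k where "k = nat \<lceil>real n * Phi t\<rceil>"
  have "0 < real n * Phi t" using \<open>0 < n\<close> Phi_pos by simp
  then have k: "real n * Phi t \<le> real k" "real k < real n * Phi t + 1" "1 \<le> k"
    unfolding k_def by linarith+
  have "real n * Phi t < real n" using \<open>0 < n\<close> Phi_less_1 by simp
  then have "k \<le> n" using k by linarith
  have Phi_grid: "Phi (Phi_inv (real i / real n)) = real i / real n" if "i \<in> {1..<n}" for i
    using that by (intro Phi_Phi_inv) auto
  show ?upper
  \<comment> \<open>Level 1 has no quantile; the trivial bound 1 on the mean replaces the grid
    there.\<close>
  proof (cases "k = n")
    case True
    have "mean n (\<lambda>l. of_bool (z l \<le> t)) \<le> mean n (\<lambda>l. 1)" by (rule mean_mono) simp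
    also have "\<dots> \<le> Phi t + 1 / real n"
      using k True \<open>0 < n\<close> by (simp add: mean_const field_simps)
    finally show ?thesis using \<open>0 \<le> \<epsilon>\<close> by simp
  next
    case False
    then have "k \<in> {1..<n}" using \<open>k \<le> n\<close> k by simp
    have "Phi t \<le> real k / real n" using k \<open>0 < n\<close> by (simp add: field_simps)
    then have "t \<le> Phi_inv (real k / real n)"
      using Phi_grid[OF \<open>k \<in> {1..<n}\<close>] Phi_le_iff by metis
    then have "mean n (\<lambda>l. of_bool (z l \<le> t)) \<le> mean n (\<lambda>l. of_bool (z l \<le> Phi_inv (real k / real n)))"
      by (intro mean_mono) auto
    also have "\<dots> \<le> real k / real n + \<epsilon>" using grid[OF \<open>k \<in> {1..<n}\<close>] by linarith
    also have "real k / real n \<le> Phi t + 1 / real n"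
      using k \<open>0 < n\<close> by (simp add: field_simps)
    finally show ?thesis by simp
  qed
  show ?lower
  \<comment> \<open>Likewise level 0 has no quantile, but then \<open>Phi t \<le> 1 / n\<close> and
    the trivial bound 0 suffices.\<close>
  proof (cases "k = 1")
    case True
    have "Phi t \<le> 1 / real n" using k True \<open>0 < n\<close> by (simp add: field_simps)
    moreover have "mean n (\<lambda>l. 0) \<le> mean n (\<lambda>l. of_bool (z l < t))" by (rule mean_mono) simp
    ultimately show ?thesis using \<open>0 \<le> \<epsilon>\<close> \<open>0 < n\<close> by (simp add: mean_const)
  next
    case False
    then have m: "k - 1 \<in> {1..<n}" using \<open>k \<le> n\<close> k by auto
    have rk: "real (k - 1) = real k - 1" using k by simp
    \<comment> \<open>Strictness here places the lower quantile strictly below \<open>t\<close>,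
      which yields the bound for \<open>z l < t\<close>.\<close>
    have "real (k - 1) / real n < Phi t" using k \<open>0 < n\<close> by (simp add: field_simps rk)
    then have "Phi_inv (real (k - 1) / real n) < t"
      using Phi_grid[OF m] Phi_less_iff by metis
    then have "mean n (\<lambda>l. of_bool (z l \<le> Phi_inv (real (k - 1) / real n))) \<le> mean n (\<lambda>l. of_bool (z l < t))"
      by (intro mean_mono) auto
    moreover have "real (k - 1) / real n - \<epsilon> \<le> mean n (\<lambda>l. of_bool (z l \<le> Phi_inv (real (k - 1) / real n)))"
      using grid[OF m] by linarith
    moreover have "Phi t - 1 / real n \<le> real (k - 1) / real n"
      using k \<open>0 < n\<close> by (simp add: field_simps rk)
    ultimately show ?thesis by linarith
  qed
qed

text \<open>Compares both \<open>w i\<close> and \<open>z i\<close> with the score clipped to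
  \<open>[-T, T]\<close>. The first distance is a probability error \<open>e\<close> divided by a
  lower bound for the density; the second is at most \<open>L\<close> and vanishes unless the score
  lies outside \<open>[-T, T]\<close>, which happens for a fraction of at most
  \<open>2 * (\<delta> + e)\<close>. The sequence \<open>u\<close> stands for the empirical
  distribution function at the observations and is only sandwiched, which allows for ties.\<close>

lemma winsorized_score_error:
  fixes z u w :: "nat \<Rightarrow> real"
  assumes n: "0 < n" and \<delta>: "0 < \<delta>" "\<delta> < 1/2"
    and T: "T = Phi_inv (1 - \<delta>)"
    and upper: "\<And>t. mean n (\<lambda>l. of_bool (z l \<le> t)) \<le> Phi t + e"
    and lower: "\<And>t. Phi t - e \<le> mean n (\<lambda>l. of_bool (z l < t))"
    and u: "\<And>i. i < n \<Longrightarrow> mean n (\<lambda>l. of_bool (z l < z i)) \<le> u i"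
      "\<And>i. i < n \<Longrightarrow> u i \<le> mean n (\<lambda>l. of_bool (z l \<le> z i))"
    and L: "\<And>i. i < n \<Longrightarrow> \<bar>z i\<bar> \<le> L"
    and w: "\<And>i. i < n \<Longrightarrow> w i = Phi_inv (max \<delta> (min (1 - \<delta>) (u i)))"
  shows "0 < T"
    and "\<And>i. i < n \<Longrightarrow> \<bar>w i\<bar> \<le> T"
    and "mean n (\<lambda>i. \<bar>w i - z i\<bar>) \<le> e / (T * \<delta>) + 2 * L * (\<delta> + e)"
proof -
  have Phi_T: "Phi T = 1 - \<delta>" unfolding T using \<delta> by (intro Phi_Phi_inv) auto
  then have Phi_mT: "Phi (- T) = \<delta>" by (simp add: Phi_minus)
  have "Phi (- T) < Phi T" using Phi_T Phi_mT \<delta> by simp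
  then show "0 < T" by (simp add: Phi_less_iff)
  have Phi_w: "Phi (w i) = max \<delta> (min (1 - \<delta>) (u i))" if "i < n" for i
    unfolding w[OF that] using \<delta> by (intro Phi_Phi_inv) auto
  show w_le: "\<bar>w i\<bar> \<le> T" if "i < n" for i
  proof -
    have "Phi (w i) \<le> Phi T" "Phi (- T) \<le> Phi (w i)"
      using Phi_w[OF that] Phi_T Phi_mT \<delta> by auto
    then show ?thesis by (simp add: Phi_le_iff)
  qed
  have dens: "T * \<delta> \<le> std_normal_density T"
    using Mills_bound[OF \<open>0 < T\<close>] Phi_T \<open>0 < T\<close> by (simp add: field_simps)
  have clip: "\<bar>w i - max (- T) (min T (z i))\<bar> \<le> e / (T * \<delta>)" if "i < n" for i
  proof -
    let ?c = "max (- T) (min T (z i))"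
    \<comment> \<open>A monotone map commutes with \<open>max\<close> and \<open>min\<close>, so
      clipping scores at \<open>T\<close> is clipping probabilities at
      \<open>\<delta>\<close>.\<close>
    have "Phi ?c = max \<delta> (min (1 - \<delta>) (Phi (z i)))"
      by (simp only: max_of_mono[OF mono_Phi, symmetric] min_of_mono[OF mono_Phi, symmetric] Phi_T Phi_mT)
    moreover have "\<bar>u i - Phi (z i)\<bar> \<le> e"
      using upper[of "z i"] lower[of "z i"] u[OF that] by linarith
    \<comment> \<open>Clipping to an interval does not increase distances.\<close>
    ultimately have "\<bar>Phi (w i) - Phi ?c\<bar> \<le> e"
      using Phi_w[OF that] \<delta> by (auto simp: max_def min_def split: if_splits)
    moreover have "std_normal_density T * \<bar>w i - ?c\<bar> \<le> \<bar>Phi (w i) - Phi ?c\<bar>"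
      using w_le[OF that] \<open>0 < T\<close> by (intro Phi_expanding) auto
    moreover have "T * \<delta> * \<bar>w i - ?c\<bar> \<le> std_normal_density T * \<bar>w i - ?c\<bar>"
      using dens by (intro mult_right_mono) auto
    ultimately have "T * \<delta> * \<bar>w i - ?c\<bar> \<le> e" by linarith
    then show ?thesis using \<open>0 < T\<close> \<delta> by (simp add: field_simps)
  qed
  have "0 \<le> L" using L[OF n] by linarith
  have "mean n (\<lambda>i. \<bar>w i - z i\<bar>) \<le>
      mean n (\<lambda>i. e / (T * \<delta>) + L * ((1 - of_bool (z i \<le> T)) + of_bool (z i < - T)))"
  proof (rule mean_mono)
    fix i assume "i < n"
    have "\<bar>max (- T) (min T (z i)) - z i\<bar> \<le> L * ((1 - of_bool (z i \<le> T)) + of_bool (z i < - T))"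
      using L[OF \<open>i < n\<close>] \<open>0 < T\<close> by (auto simp: max_def min_def)
    then show "\<bar>w i - z i\<bar> \<le> e / (T * \<delta>) + L * ((1 - of_bool (z i \<le> T)) + of_bool (z i < - T))"
      using clip[OF \<open>i < n\<close>] by linarith
  qed
  also have "\<dots> = e / (T * \<delta>) +
      L * ((1 - mean n (\<lambda>i. of_bool (z i \<le> T))) + mean n (\<lambda>i. of_bool (z i < - T)))"
    using n by (simp only: mean_add mean_diff mean_cmult mean_const)
  \<comment> \<open>The fraction above \<open>T\<close> is controlled by \<open>lower\<close> at
    \<open>T\<close>, the fraction below \<open>- T\<close> by \<open>upper\<close> at
    \<open>- T\<close>.\<close>
  also have "\<dots> \<le> e / (T * \<delta>) + L * ((\<delta> + e) + (\<delta> + e))"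
  proof -
    have "mean n (\<lambda>i. of_bool (z i < T)) \<le> mean n (\<lambda>i. of_bool (z i \<le> T))"
      "mean n (\<lambda>i. of_bool (z i < - T)) \<le> mean n (\<lambda>i. of_bool (z i \<le> - T))"
      by (auto intro!: mean_mono)
    then show ?thesis
      using lower[of T] upper[of "- T"] Phi_T Phi_mT \<open>0 \<le> L\<close>
      by (intro add_left_mono mult_left_mono add_mono) auto
  qed
  finally show "mean n (\<lambda>i. \<bar>w i - z i\<bar>) \<le> e / (T * \<delta>) + 2 * L * (\<delta> + e)"
    by (simp add: algebra_simps)
qed

section \<open>Probability of irregular samples\<close>

text \<open>Evaluates the normal law at the linear functional given by the \<open>j\<close>-th unit
  vector. Its variance is \<open>V j j = 1\<close>, so the nondegenerate branch of the definition
  applies.\<close>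

lemma nonparanormal_coordinate:
  assumes npn: "nonparanormal p \<mu> V f P" and j: "j < p" and "V j j = 1" "\<mu> j = 0"
  shows "(\<lambda>x. f j (x j)) \<in> borel_measurable (borel_vec p)"
    and "distr P borel (\<lambda>x. f j (x j)) = std_normal_distribution"
proof -
  have f: "f i \<in> borel_measurable borel" if "i < p" for i
    using npn that by (simp add: nonparanormal_def)
  have sets_P: "sets P = sets (borel_vec p)" using npn by (simp add: nonparanormal_def)
  have comp: "(\<lambda>x. f i (x i)) \<in> borel_measurable (borel_vec p)" if "i < p" for i
    using that by (intro measurable_compose[OF _ f[OF that]] measurable_component_singleton) auto
  then show "(\<lambda>x. f j (x j)) \<in> borel_measurable (borel_vec p)" using j by simp
  have vec: "(\<lambda>x. \<lambda>i\<in>{..<p}. f i (x i)) \<in> measurable P (borel_vec p)"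
    unfolding measurable_cong_sets[OF sets_P refl] by (intro measurable_restrict comp) auto
  define a :: "nat \<Rightarrow> real" where "a i = of_bool (i = j)" for i
  have sum_a: "(\<Sum>i<p. a i * g i) = g j" for g :: "nat \<Rightarrow> real"
    using j by (simp add: a_def of_bool_def if_distrib[of "\<lambda>c. c * _"] cong: if_cong)
  have var: "(\<Sum>i<p. \<Sum>k<p. a i * a k * V i k) = 1"
    using sum_a assms by (simp add: mult.assoc sum_distrib_left[symmetric])
  have mvn: "multivariate_normal p \<mu> V (distr P (borel_vec p) (\<lambda>x. \<lambda>i\<in>{..<p}. f i (x i)))"
    using npn by (simp add: nonparanormal_def)
  have "distr (distr P (borel_vec p) (\<lambda>x. \<lambda>i\<in>{..<p}. f i (x i))) borel (\<lambda>x. \<Sum>i<p. a i * x i)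
      = density lborel (normal_density 0 (sqrt 1))"
    using mvn[unfolded multivariate_normal_def, THEN conjunct2, THEN conjunct2, THEN conjunct2,
        THEN spec[of _ a], unfolded Let_def var] sum_a[of \<mu>] \<open>\<mu> j = 0\<close> by simp
  moreover have "distr (distr P (borel_vec p) (\<lambda>x. \<lambda>i\<in>{..<p}. f i (x i))) borel (\<lambda>x. \<Sum>i<p. a i * x i)
      = distr P borel ((\<lambda>x. \<Sum>i<p. a i * x i) \<circ> (\<lambda>x. \<lambda>i\<in>{..<p}. f i (x i)))"
    by (rule distr_distr[OF _ vec])
       (auto intro!: borel_measurable_sum borel_measurable_times measurable_component_singleton)
  moreover have "(\<lambda>x. \<Sum>i<p. a i * x i) \<circ> (\<lambda>x. \<lambda>i\<in>{..<p}. f i (x i)) = (\<lambda>x. f j (x j))"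
    using j by (simp add: fun_eq_iff sum_a)
  ultimately show "distr P borel (\<lambda>x. f j (x j)) = std_normal_distribution" by simp
qed

section \<open>Gaussian probabilities and concentration for one coordinate\<close>

lemma measure_std_normal_distribution_atMost: "measure std_normal_distribution {..x} = Phi x"
  by (simp add: Phi_def cdf_def)

text \<open>Continuity of \<open>Phi\<close> excludes atoms. This disposes of the scores that equal
  a default value of \<open>Phi_inv\<close>.\<close>

lemma measure_std_normal_distribution_finite:
  assumes "finite S"
  shows "measure std_normal_distribution S = 0"
proof -
  have "isCont Phi x" for x by (rule DERIV_isCont[OF has_real_derivative_Phi])
  then have "measure std_normal_distribution {x} = 0" for x
    using std_normal.isCont_cdf[of x] by (simp add: Phi_def)
  then show ?thesis
    using assms by (subst std_normal.finite_measure_eq_sum_singleton) auto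
qed

lemma measure_std_normal_distribution_tail:
  assumes "0 < t"
  shows "measure std_normal_distribution {x. \<bar>x\<bar> > t} \<le> 2 * std_normal_density t / t"
proof -
  have "measure std_normal_distribution {x. \<bar>x\<bar> > t}
      \<le> measure std_normal_distribution ({..- t} \<union> (UNIV - {..t}))"
    by (intro std_normal.finite_measure_mono) auto
  also have "\<dots> \<le> measure std_normal_distribution {..- t} + measure std_normal_distribution (UNIV - {..t})"
    by (intro measure_Un_le) auto
  also have "measure std_normal_distribution (UNIV - {..t}) = 1 - Phi t"
    using std_normal.prob_compl[of "{..t}"] by (simp add: measure_std_normal_distribution_atMost)
  also have "measure std_normal_distribution {..- t} = 1 - Phi t"
    by (simp add: measure_std_normal_distribution_atMost Phi_minus)
  finally show ?thesis using Mills_bound[OF assms] by simp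
qed

context prob_space
begin

lemma prob_std_normal:
  assumes "random_variable borel Y" "distr M borel Y = std_normal_distribution" "S \<in> sets borel"
  shows "prob {\<omega> \<in> space M. Y \<omega> \<in> S} = measure std_normal_distribution S"
  using measure_distr[OF assms(1,3)] assms(2) by (simp add: vimage_def Int_def conj_commute)

text \<open>Hoeffding's inequality for \<open>n\<close> indicators with values in
  \<open>[0, 1]\<close> and deviation \<open>n * \<epsilon>\<close> of their sum.\<close>

lemma std_normal_ecdf_deviation:
  assumes n: "0 < n" and "0 \<le> \<epsilon>"
    and indep: "indep_vars (\<lambda>_. borel) Y {..<n}"
    and law: "\<And>i. i < n \<Longrightarrow> distr M borel (Y i) = std_normal_distribution"
  shows "prob {\<omega> \<in> space M. \<bar>mean n (\<lambda>l. of_bool (Y l \<omega> \<le> q)) - Phi q\<bar> \<ge> \<epsilon>}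
    \<le> 2 * exp (- 2 * real n * \<epsilon>\<^sup>2)"
proof -
  have rv: "random_variable borel (Y i)" if "i < n" for i
    using indep that by (simp add: indep_vars_def)
  have ind: "indep_vars (\<lambda>_. borel) (\<lambda>i \<omega>. of_bool (Y i \<omega> \<le> q) :: real) {..<n}"
    by (rule indep_vars_compose2[OF indep]) measurable
  have exp: "expectation (\<lambda>\<omega>. of_bool (Y i \<omega> \<le> q)) = Phi q" if "i < n" for i
  proof -
    have "expectation (\<lambda>\<omega>. of_bool (Y i \<omega> \<le> q)) = expectation (indicator {\<omega> \<in> space M. Y i \<omega> \<in> {..q}})"
      by (intro Bochner_Integration.integral_cong) (auto simp: indicator_def)
    also have "\<dots> = Phi q"
      using rv[OF that] law[OF that] prob_std_normal[of "Y i" "{..q}"]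
      by (simp add: measure_std_normal_distribution_atMost Int_absorb1)
    finally show ?thesis .
  qed
  interpret Hoeffding_ineq M "{..<n}" "\<lambda>i \<omega>. of_bool (Y i \<omega> \<le> q)" "\<lambda>_. 0" "\<lambda>_. 1" "real n * Phi q"
  proof unfold_locales
    show "real n * Phi q \<equiv> \<Sum>i<n. expectation (\<lambda>\<omega>. of_bool (Y i \<omega> \<le> q))"
      by (rule eq_reflection) (simp add: exp)
  qed (auto intro: ind)
  have scale: "(\<bar>(\<Sum>i<n. of_bool (Y i \<omega> \<le> q)) - real n * Phi q\<bar> \<ge> real n * \<epsilon>) \<longleftrightarrow>
      \<bar>mean n (\<lambda>l. of_bool (Y l \<omega> \<le> q)) - Phi q\<bar> \<ge> \<epsilon>" for \<omega>
  proof -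
    have "(\<Sum>i<n. of_bool (Y i \<omega> \<le> q)) - real n * Phi q
        = real n * (mean n (\<lambda>l. of_bool (Y l \<omega> \<le> q)) - Phi q)"
      using n by (simp add: mean_def right_diff_distrib)
    then show ?thesis using n by (simp add: abs_mult)
  qed
  have "prob {\<omega> \<in> space M. \<bar>(\<Sum>i<n. of_bool (Y i \<omega> \<le> q)) - real n * Phi q\<bar> \<ge> real n * \<epsilon>}
      \<le> 2 * exp (- 2 * (real n * \<epsilon>)\<^sup>2 / (\<Sum>i<n. (1 - 0)\<^sup>2))"
    using n \<open>0 \<le> \<epsilon>\<close> by (intro Hoeffding_ineq_abs_ge) auto
  also have "- 2 * (real n * \<epsilon>)\<^sup>2 / (\<Sum>i<n. (1 - 0)\<^sup>2) = - 2 * real n * \<epsilon>\<^sup>2"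
    using n by (simp add: power2_eq_square)
  finally show ?thesis by (simp only: scale)
qed

text \<open>The bad event of a single coordinate. Testing the empirical distribution function at
  finitely many quantiles only, instead of at all reals, makes a union bound possible.\<close>

definition irregular :: "nat \<Rightarrow> real \<Rightarrow> real \<Rightarrow> real set \<Rightarrow> (nat \<Rightarrow> 'a \<Rightarrow> real) \<Rightarrow> 'a set" where
  "irregular n L \<epsilon> S Y = {\<omega> \<in> space M. (\<exists>i<n. \<bar>Y i \<omega>\<bar> > L \<or> Y i \<omega> \<in> S) \<or>
     (\<exists>k\<in>{1..<n}. \<bar>mean n (\<lambda>l. of_bool (Y l \<omega> \<le> Phi_inv (real k / real n))) - real k / real n\<bar> \<ge> \<epsilon>)}"

text \<open>Union bound over the \<open>n\<close> observations and the \<open>n - 1\<close> grid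
  levels; hitting the finite set \<open>S\<close> has probability 0.\<close>

lemma prob_irregular:
  assumes n: "0 < n" and "0 \<le> \<epsilon>" "0 < L" "finite S"
    and indep: "indep_vars (\<lambda>_. borel) Y {..<n}"
    and law: "\<And>i. i < n \<Longrightarrow> distr M borel (Y i) = std_normal_distribution"
  shows "irregular n L \<epsilon> S Y \<in> events"
    and "prob (irregular n L \<epsilon> S Y) \<le>
      real n * (2 * std_normal_density L / L + 2 * exp (- 2 * real n * \<epsilon>\<^sup>2))"
proof -
  have rv [measurable]: "random_variable borel (Y i)" if "i < n" for i
    using indep that by (simp add: indep_vars_def)
  define A where "A i = {\<omega> \<in> space M. Y i \<omega> \<in> {x. \<bar>x\<bar> > L} \<union> S}" for i
  define B where "B k = {\<omega> \<in> space M.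
    \<bar>mean n (\<lambda>l. of_bool (Y l \<omega> \<le> Phi_inv (real k / real n))) - real k / real n\<bar> \<ge> \<epsilon>}" for k
  have S: "{x. \<bar>x\<bar> > L} \<union> S \<in> sets borel" "S \<in> sets borel"
  proof -
    show "S \<in> sets borel" using \<open>finite S\<close> by (intro borel_closed finite_imp_closed)
    then show "{x. \<bar>x\<bar> > L} \<union> S \<in> sets borel" by (intro sets.Un) auto
  qed
  have A: "A i \<in> events" if "i < n" for i
    unfolding A_def using measurable_sets[OF rv[OF that] S(1)]
    by (simp add: vimage_def Int_def conj_commute)
  have B: "B k \<in> events" for k
    unfolding B_def mean_def by measurable
  have eq: "irregular n L \<epsilon> S Y = (\<Union>i\<in>{..<n}. A i) \<union> (\<Union>k\<in>{1..<n}. B k)"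
    by (auto simp: irregular_def A_def B_def)
  show "irregular n L \<epsilon> S Y \<in> events"
    unfolding eq using A B by (intro sets.Un sets.finite_UN) auto
  have probA: "prob (A i) \<le> 2 * std_normal_density L / L" if "i < n" for i
  proof -
    have "prob (A i) = measure std_normal_distribution ({x. \<bar>x\<bar> > L} \<union> S)"
      unfolding A_def by (rule prob_std_normal[OF rv[OF that] law[OF that] S(1)])
    also have "\<dots> \<le> measure std_normal_distribution {x. \<bar>x\<bar> > L} + measure std_normal_distribution S"
      using S(2) by (intro measure_Un_le) auto
    also have "\<dots> \<le> 2 * std_normal_density L / L"
      using measure_std_normal_distribution_tail[OF \<open>0 < L\<close>]
        measure_std_normal_distribution_finite[OF \<open>finite S\<close>] by simp
    finally show ?thesis .
  qed
  have probB: "prob (B k) \<le> 2 * exp (- 2 * real n * \<epsilon>\<^sup>2)" if "k \<in> {1..<n}" for k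
  proof -
    have "Phi (Phi_inv (real k / real n)) = real k / real n"
      using that by (intro Phi_Phi_inv) auto
    then show ?thesis
      using std_normal_ecdf_deviation[OF n \<open>0 \<le> \<epsilon>\<close> indep law, of "Phi_inv (real k / real n)"]
      by (simp add: B_def)
  qed
  have "prob (irregular n L \<epsilon> S Y) \<le> prob (\<Union>i\<in>{..<n}. A i) + prob (\<Union>k\<in>{1..<n}. B k)"
    unfolding eq using A B by (intro measure_Un_le sets.finite_UN) auto
  also have "\<dots> \<le> (\<Sum>i\<in>{..<n}. prob (A i)) + (\<Sum>k\<in>{1..<n}. prob (B k))"
    using A B by (intro add_mono finite_measure_subadditive_finite) auto
  also have "\<dots> \<le> (\<Sum>i\<in>{..<n}. 2 * std_normal_density L / L) + (\<Sum>k\<in>{1..<n}. 2 * exp (- 2 * real n * \<epsilon>\<^sup>2))"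
    using probA probB by (intro add_mono sum_mono) auto
  also have "\<dots> \<le> real n * (2 * std_normal_density L / L) + real n * (2 * exp (- 2 * real n * \<epsilon>\<^sup>2))"
    by (simp add: mult_right_mono)
  finally show "prob (irregular n L \<epsilon> S Y) \<le>
      real n * (2 * std_normal_density L / L + 2 * exp (- 2 * real n * \<epsilon>\<^sup>2))"
    by (simp add: distrib_left)
qed

end

section \<open>From regular samples to the maximal covariance error\<close>

lemma max_cov_error_le:
  assumes "0 < p"
    and "\<And>j k. j < p \<Longrightarrow> k < p \<Longrightarrow>
      \<bar>sample_cov n x (winsor_transform n x) j k - sample_cov n x f j k\<bar> \<le> b"
  shows "max_cov_error n p x f \<le> b"
proof -
  let ?S = "{\<bar>sample_cov n x (winsor_transform n x) j k - sample_cov n x f j k\<bar> | j k. j < p \<and> k < p}"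
  have "finite ?S" by (rule finite_image_set2) auto
  moreover have "?S \<noteq> {}" using \<open>0 < p\<close> by blast
  ultimately show ?thesis
    unfolding max_cov_error_def using assms(2) by (subst Max_le_iff) auto
qed

lemma emp_cdf_eq_mean: "emp_cdf n x j t = mean n (\<lambda>l. of_bool (x l j \<le> t))"
  by (simp add: emp_cdf_def mean_def of_bool_def)

text \<open>As \<open>trunc_param n\<close> lies below \<open>1 - trunc_param n\<close>, the three
  cases amount to clipping.\<close>

lemma winsor_transform_eq:
  assumes "trunc_param n < 1/2"
  shows "winsor_transform n x j t =
    Phi_inv (max (trunc_param n) (min (1 - trunc_param n) (emp_cdf n x j t)))"
  using assms by (auto simp: winsor_transform_def winsor_cdf_def max_def min_def)

text \<open>The last factor is the mean score error from \<open>winsorized_score_error\<close>, with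
  \<open>1 / n\<close> added to \<open>\<epsilon>\<close> for the spacing of the grid. The factors
  \<open>2 * T\<close> and \<open>2 * L\<close> come from \<open>abs_covar_le\<close>, for
  Winsorized and true scores.\<close>

definition error_bound :: "nat \<Rightarrow> real \<Rightarrow> real \<Rightarrow> real" where
  "error_bound n L \<epsilon> =
    (let \<delta> = trunc_param n; T = Phi_inv (1 - \<delta>); e = \<epsilon> + 1 / real n in
      2 * (T + L) * (e / (T * \<delta>) + 2 * L * (\<delta> + e)))"

text \<open>
  The two exceptional scores are the junk values of \<^const>\<open>Phi_inv\<close>: a score different from both
  comes from an observation with \<open>0 < F\<^sub>j < 1\<close>, so that \<open>\<Phi>(f\<^sub>j(x)) = F\<^sub>j(x)\<close>.
\<close>

lemma regular_sample_error:
  assumes n: "0 < n" and p: "0 < p" and "0 \<le> \<epsilon>"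
    and \<delta>: "0 < trunc_param n" "trunc_param n < 1/2"
    and F: "\<And>j. j < p \<Longrightarrow> mono (F j)" "\<And>j t. j < p \<Longrightarrow> F j t \<in> {0..1}"
    and f: "\<And>j. j < p \<Longrightarrow> f j = Phi_inv \<circ> F j"
    and L: "\<And>i j. i < n \<Longrightarrow> j < p \<Longrightarrow> \<bar>f j (x i j)\<bar> \<le> L"
    and reg: "\<And>i j. i < n \<Longrightarrow> j < p \<Longrightarrow> f j (x i j) \<notin> {Phi_inv 0, Phi_inv 1}"
    and grid: "\<And>j k. j < p \<Longrightarrow> k \<in> {1..<n} \<Longrightarrow>
      \<bar>mean n (\<lambda>l. of_bool (f j (x l j) \<le> Phi_inv (real k / real n))) - real k / real n\<bar> \<le> \<epsilon>"
  shows "max_cov_error n p x f \<le> error_bound n L \<epsilon>"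
proof (rule max_cov_error_le[OF p])
  define e where "e = \<epsilon> + 1 / real n"
  define T where "T = Phi_inv (1 - trunc_param n)"
  define m where "m = e / (T * trunc_param n) + 2 * L * (trunc_param n + e)"
  let ?w = "\<lambda>j i. winsor_transform n x j (x i j)"
  have Phi_score: "Phi (f j (x i j)) = F j (x i j)" if "i < n" "j < p" for i j
  proof -
    have "F j (x i j) \<noteq> 0" "F j (x i j) \<noteq> 1"
      using reg[OF that] f[OF \<open>j < p\<close>] by auto
    then have "0 < F j (x i j)" "F j (x i j) < 1"
      using F(2)[OF \<open>j < p\<close>, of "x i j"] by auto
    then show ?thesis using f[OF \<open>j < p\<close>] by (simp add: Phi_Phi_inv)
  qed
  have score:
    "0 < T \<and> (\<forall>i<n. \<bar>?w j i\<bar> \<le> T) \<and> mean n (\<lambda>i. \<bar>?w j i - f j (x i j)\<bar>) \<le> m"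
    if "j < p" for j
  proof -
    \<comment> \<open>\<open>F j\<close> may be flat, so distinct observations can have equal
      scores. Monotonicity still puts the empirical distribution function of the observations
      between the strict and the weak one of the scores.\<close>
    have lower: "mean n (\<lambda>l. of_bool (f j (x l j) < f j (x i j))) \<le> emp_cdf n x j (x i j)"
      if "i < n" for i
      unfolding emp_cdf_eq_mean
    proof (rule mean_mono)
      fix l assume "l < n"
      have "x l j \<le> x i j" if "f j (x l j) < f j (x i j)"
      proof (rule ccontr)
        assume "\<not> x l j \<le> x i j"
        then have "F j (x i j) \<le> F j (x l j)" using F(1)[OF \<open>j < p\<close>] by (simp add: mono_def)
        then show False
          using that Phi_score \<open>i < n\<close> \<open>l < n\<close> \<open>j < p\<close> by (metis Phi_le_iff not_le)
      qed
      then show "of_bool (f j (x l j) < f j (x i j)) \<le> (of_bool (x l j \<le> x i j) :: real)" by simp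
    qed
    have upper: "emp_cdf n x j (x i j) \<le> mean n (\<lambda>l. of_bool (f j (x l j) \<le> f j (x i j)))"
      if "i < n" for i
      unfolding emp_cdf_eq_mean
    proof (rule mean_mono)
      fix l assume "l < n"
      have "f j (x l j) \<le> f j (x i j)" if "x l j \<le> x i j"
        using that Phi_score \<open>i < n\<close> \<open>l < n\<close> \<open>j < p\<close> F(1)[OF \<open>j < p\<close>] by (metis Phi_le_iff monoD)
      then show "of_bool (x l j \<le> x i j) \<le> (of_bool (f j (x l j) \<le> f j (x i j)) :: real)" by simp
    qed
    have grid_j: "k \<in> {1..<n} \<Longrightarrow>
        \<bar>mean n (\<lambda>l. of_bool (f j (x l j) \<le> Phi_inv (real k / real n))) - real k / real n\<bar> \<le> \<epsilon>" for k
      by (rule grid[OF \<open>j < p\<close>])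
    have ecdf: "mean n (\<lambda>l. of_bool (f j (x l j) \<le> t)) \<le> Phi t + e"
      "Phi t - e \<le> mean n (\<lambda>l. of_bool (f j (x l j) < t))" for t
      unfolding e_def
      by (rule empirical_Phi_from_grid[OF n \<open>0 \<le> \<epsilon>\<close>, where z = "\<lambda>l. f j (x l j)"]; erule grid_j)+
    note err = winsorized_score_error[where z = "\<lambda>i. f j (x i j)" and u = "\<lambda>i. emp_cdf n x j (x i j)"
        and w = "?w j" and L = L, OF n \<delta> T_def ecdf]
    have "0 < T"
      by (rule err(1)) (auto simp: lower upper L \<open>j < p\<close> winsor_transform_eq[OF \<delta>(2)])
    moreover have "\<bar>?w j i\<bar> \<le> T" if "i < n" for i
      by (rule err(2)) (use that in \<open>auto simp: lower upper L \<open>j < p\<close> winsor_transform_eq[OF \<delta>(2)]\<close>)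
    moreover have "mean n (\<lambda>i. \<bar>?w j i - f j (x i j)\<bar>) \<le> m"
      unfolding m_def
      by (rule err(3)) (auto simp: lower upper L \<open>j < p\<close> winsor_transform_eq[OF \<delta>(2)])
    ultimately show ?thesis by blast
  qed
  have eb: "error_bound n L \<epsilon> = 2 * T * m + 2 * L * m"
    unfolding error_bound_def Let_def m_def e_def T_def by (simp only: distrib_left distrib_right)
  fix j k assume "j < p" "k < p"
  have "sample_cov n x (winsor_transform n x) j k - sample_cov n x f j k =
      covar n (?w j) (\<lambda>i. ?w k i - f k (x i k)) + covar n (\<lambda>i. f k (x i k)) (\<lambda>i. ?w j i - f j (x i j))"
    unfolding sample_cov_eq_covar by (rule covar_diff[OF n])
  moreover have "\<bar>covar n (?w j) (\<lambda>i. ?w k i - f k (x i k))\<bar> \<le> 2 * T * m"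
    using score \<open>j < p\<close> \<open>k < p\<close> by (intro abs_covar_le n) auto
  moreover have "\<bar>covar n (\<lambda>i. f k (x i k)) (\<lambda>i. ?w j i - f j (x i j))\<bar> \<le> 2 * L * m"
    using score \<open>j < p\<close> \<open>k < p\<close> L by (intro abs_covar_le n) auto
  ultimately show "\<bar>sample_cov n x (winsor_transform n x) j k - sample_cov n x f j k\<bar> \<le> error_bound n L \<epsilon>"
    unfolding eb by linarith
qed

text \<open>Off the irregular events of all coordinates the deterministic bound applies. The union
  bound over coordinates copes with any dependence between them.\<close>

lemma max_cov_error_tail:
  assumes n: "0 < n" and p: "0 < p" and "0 \<le> \<epsilon>" "0 < L"
    and \<delta>: "0 < trunc_param n" "trunc_param n < 1/2"
    and f: "\<And>j. j < p \<Longrightarrow> f j = Phi_inv \<circ> marginal_cdf P j"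
    and npn: "nonparanormal p (\<lambda>_. 0) V f P" and V: "\<And>j. j < p \<Longrightarrow> V j j = 1"
    and iid: "iid_sample n p P \<Omega> X"
    and b: "error_bound n L \<epsilon> \<le> b"
  shows "measure \<Omega> {\<omega> \<in> space \<Omega>. max_cov_error n p (\<lambda>i. X i \<omega>) f > b}
    \<le> real p * (real n * (2 * std_normal_density L / L + 2 * exp (- 2 * real n * \<epsilon>\<^sup>2)))"
proof -
  interpret prob_space \<Omega> using iid by (simp add: iid_sample_def)
  interpret P: prob_space P using npn by (simp add: nonparanormal_def)
  have sets_P: "sets P = sets (borel_vec p)" using npn by (simp add: nonparanormal_def)
  have indep: "indep_vars (\<lambda>_. borel_vec p) X {..<n}" using iid by (simp add: iid_sample_def)
  have X: "random_variable (borel_vec p) (X i)" if "i < n" for i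
    using indep that by (simp add: indep_vars_def)
  define Y where "Y j i \<omega> = f j (X i \<omega> j)" for j i \<omega>
  have coord: "(\<lambda>x. f j (x j)) \<in> borel_measurable (borel_vec p)"
    "distr P borel (\<lambda>x. f j (x j)) = std_normal_distribution" if "j < p" for j
    using nonparanormal_coordinate[OF npn that] V[OF that] by auto
  have indep_Y: "indep_vars (\<lambda>_. borel) (Y j) {..<n}" if "j < p" for j
    unfolding Y_def[abs_def] by (rule indep_vars_compose2[OF indep]) (rule coord[OF that])
  have law: "distr \<Omega> borel (Y j i) = std_normal_distribution" if "j < p" "i < n" for i j
  proof -
    have "distr P borel (\<lambda>x. f j (x j)) = distr (distr \<Omega> (borel_vec p) (X i)) borel (\<lambda>x. f j (x j))"
      using iid \<open>i < n\<close> by (simp add: iid_sample_def)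
    also have "\<dots> = distr \<Omega> borel ((\<lambda>x. f j (x j)) \<circ> X i)"
      by (rule distr_distr[OF coord(1)[OF \<open>j < p\<close>] X[OF \<open>i < n\<close>]])
    finally show ?thesis using coord(2)[OF \<open>j < p\<close>] by (simp add: Y_def[abs_def] comp_def)
  qed
  define B where "B j = irregular n L \<epsilon> {Phi_inv 0, Phi_inv 1} (Y j)" for j
  have B: "B j \<in> events"
    "prob (B j) \<le> real n * (2 * std_normal_density L / L + 2 * exp (- 2 * real n * \<epsilon>\<^sup>2))"
    if "j < p" for j
    unfolding B_def using prob_irregular[OF n \<open>0 \<le> \<epsilon>\<close> \<open>0 < L\<close> _ indep_Y[OF that] law[OF that]] by auto
  have F: "mono (marginal_cdf P j)" "marginal_cdf P j t \<in> {0..1}" if "j < p" for j t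
  proof -
    have "(\<lambda>x. x j) \<in> borel_measurable P"
      unfolding measurable_cong_sets[OF sets_P refl] using that
      by (intro measurable_component_singleton) auto
    then interpret D: real_distribution "distr P borel (\<lambda>x. x j)"
      by (rule P.real_distribution_distr)
    show "mono (marginal_cdf P j)" "marginal_cdf P j t \<in> {0..1}"
      using D.cdf_nondecreasing D.cdf_nonneg D.cdf_bounded_prob
      by (auto simp: marginal_cdf_def mono_def)
  qed
  have "{\<omega> \<in> space \<Omega>. max_cov_error n p (\<lambda>i. X i \<omega>) f > b} \<subseteq> (\<Union>j\<in>{..<p}. B j)"
  proof (rule subsetI, rule ccontr)
    fix \<omega> assume \<omega>: "\<omega> \<in> {\<omega> \<in> space \<Omega>. max_cov_error n p (\<lambda>i. X i \<omega>) f > b}"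
      and "\<omega> \<notin> (\<Union>j\<in>{..<p}. B j)"
    then have good: "\<omega> \<notin> B j" "\<omega> \<in> space \<Omega>" if "j < p" for j using that by auto
    have "max_cov_error n p (\<lambda>i. X i \<omega>) f \<le> error_bound n L \<epsilon>"
    proof (rule regular_sample_error[OF n p \<open>0 \<le> \<epsilon>\<close> \<delta> F f])
      fix j assume j: "j < p"
      have reg: "\<not> (\<exists>i<n. \<bar>Y j i \<omega>\<bar> > L \<or> Y j i \<omega> \<in> {Phi_inv 0, Phi_inv 1})"
        and grid: "\<not> (\<exists>k\<in>{1..<n}.
          \<bar>mean n (\<lambda>l. of_bool (Y j l \<omega> \<le> Phi_inv (real k / real n))) - real k / real n\<bar> \<ge> \<epsilon>)"
        using good[OF j] unfolding B_def irregular_def by blast+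
      show "\<bar>f j (X i \<omega> j)\<bar> \<le> L" if "i < n" for i
      proof -
        have "\<not> \<bar>Y j i \<omega>\<bar> > L" using reg that by blast
        then show ?thesis by (simp add: Y_def)
      qed
      show "f j (X i \<omega> j) \<notin> {Phi_inv 0, Phi_inv 1}" if "i < n" for i
      proof -
        have "Y j i \<omega> \<notin> {Phi_inv 0, Phi_inv 1}" using reg that by blast
        then show ?thesis by (simp add: Y_def)
      qed
      show "\<bar>mean n (\<lambda>l. of_bool (f j (X l \<omega> j) \<le> Phi_inv (real k / real n))) - real k / real n\<bar> \<le> \<epsilon>"
        if "k \<in> {1..<n}" for k
      proof -
        have "\<not> \<bar>mean n (\<lambda>l. of_bool (Y j l \<omega> \<le> Phi_inv (real k / real n))) - real k / real n\<bar> \<ge> \<epsilon>"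
          using grid that by blast
        then show ?thesis by (simp add: Y_def)
      qed
    qed
    then show False using \<omega> b by simp
  qed
  \<comment> \<open>Monotonicity of the measure asks for measurability of the larger event, the
    union of the \<open>B j\<close>.\<close>
  then have "prob {\<omega> \<in> space \<Omega>. max_cov_error n p (\<lambda>i. X i \<omega>) f > b} \<le> prob (\<Union>j\<in>{..<p}. B j)"
    using B by (intro finite_measure_mono sets.finite_UN) auto
  also have "\<dots> \<le> (\<Sum>j\<in>{..<p}. prob (B j))"
    using B by (intro finite_measure_subadditive_finite) auto
  also have "\<dots> \<le> (\<Sum>j\<in>{..<p}. real n * (2 * std_normal_density L / L + 2 * exp (- 2 * real n * \<epsilon>\<^sup>2)))"
    using B by (intro sum_mono) auto
  finally show ?thesis by simp
qed

section \<open>Asymptotics\<close>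

lemma trunc_param_small: "\<forall>\<^sub>F n in sequentially. 0 < trunc_param n \<and> trunc_param n < 1/2"
proof -
  have "\<forall>\<^sub>F n in sequentially. 0 < trunc_param n" unfolding trunc_param_def by real_asymp
  moreover have "\<forall>\<^sub>F n in sequentially. trunc_param n < 1/2" unfolding trunc_param_def by real_asymp
  ultimately show ?thesis by (rule eventually_conj)
qed

text \<open>With \<open>s = sqrt (ln n)\<close>, the Gaussian tail at \<open>s / 2\<close> is at
  least a constant times \<open>n^(-1/4)\<close>, and the tail at \<open>2 * s\<close> is at most of
  order \<open>n^(-2) / s\<close>. Eventually \<open>trunc_param n\<close> lies between the two, so
  its quantile lies between the two points.\<close>

lemma trunc_point_bounds:
  "\<forall>\<^sub>F n in sequentially. sqrt (ln (real n)) / 2 \<le> Phi_inv (1 - trunc_param n) \<and>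
     Phi_inv (1 - trunc_param n) \<le> 2 * sqrt (ln (real n))"
proof -
  have "\<forall>\<^sub>F n in sequentially. trunc_param n \<le> 1 / sqrt (2 * pi) * exp (- (ln (real n) / 4 + 1))"
    unfolding trunc_param_def by real_asymp
  moreover have "\<forall>\<^sub>F n in sequentially.
      1 / sqrt (2 * pi) * exp (- (2 * ln (real n))) / (2 * sqrt (ln (real n))) \<le> trunc_param n"
    unfolding trunc_param_def by real_asymp
  ultimately show ?thesis
    using trunc_param_small eventually_gt_at_top[of 1]
  proof eventually_elim
    case (elim n)
    define s where "s = sqrt (ln (real n))"
    have "0 < s" using elim by (simp add: s_def)
    have T: "Phi (Phi_inv (1 - trunc_param n)) = 1 - trunc_param n"
      using elim by (intro Phi_Phi_inv) auto
    \<comment> \<open>Since \<open>(a + 1)^2 + (a - 1)^2 = 2 * a^2 + 2\<close> with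
      \<open>a = s / 2\<close>, this bounds the exponent of the density at
      \<open>s / 2 + 1\<close>.\<close>
    have "0 \<le> (s / 2 - 1)\<^sup>2" by simp
    moreover have s2: "s\<^sup>2 = ln (real n)" using elim by (simp add: s_def)
    ultimately have "(s / 2 + 1)\<^sup>2 / 2 \<le> ln (real n) / 4 + 1"
      by (simp add: power2_eq_square algebra_simps)
    then have "1 / sqrt (2 * pi) * exp (- (ln (real n) / 4 + 1)) \<le> std_normal_density (s / 2 + 1)"
      unfolding std_normal_density_def by (intro mult_left_mono) auto
    then have "Phi (s / 2) \<le> 1 - trunc_param n"
      using Phi_tail_lower_bound[of "s / 2"] \<open>0 < s\<close> elim(1) by simp
    moreover have "std_normal_density (2 * s) = 1 / sqrt (2 * pi) * exp (- (2 * ln (real n)))"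
      using s2 by (simp add: std_normal_density_def power_mult_distrib)
    then have "1 - trunc_param n \<le> Phi (2 * s)"
      using Mills_bound[of "2 * s"] \<open>0 < s\<close> elim(2) by (simp add: s_def)
    ultimately have "Phi (s / 2) \<le> Phi (Phi_inv (1 - trunc_param n))"
      "Phi (Phi_inv (1 - trunc_param n)) \<le> Phi (2 * s)"
      using T by simp_all
    then show ?case by (simp add: Phi_le_iff s_def)
  qed
qed

text \<open>Up to constants the error is at most \<open>main n\<close>, of order
  \<open>s^2 / n^(1/4)\<close> with \<open>s = sqrt (ln n)\<close>, while the claimed rate has order
  \<open>s^3 / n^(1/4)\<close>. The spare factor \<open>s\<close> absorbs every constant, however
  small \<open>K\<close> is.\<close>

lemma error_bound_le_cov_rate:
  fixes \<xi> c K :: real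
  assumes "0 < \<xi>" "2 \<le> c" "0 < K"
  shows "\<forall>\<^sub>F n in sequentially. \<forall>p. \<xi> / 2 * ln (real n) \<le> ln (real p) \<longrightarrow>
    error_bound n (c * sqrt (ln (real n))) (c * sqrt (ln (real n)) / sqrt (real n)) \<le> K * cov_rate n p"
proof -
  \<comment> \<open>Chosen so that
    \<open>16 * c^3 * \<kappa> = K * sqrt (\<xi> / 2)\<close>.\<close>
  define \<kappa> where "\<kappa> = K * sqrt (\<xi> / 2) / (16 * c ^ 3)"
  have "0 < \<kappa>" using assms by (simp add: \<kappa>_def)
  define s :: "nat \<Rightarrow> real" where "s n = sqrt (ln (real n))" for n
  define main where "main n = s n / (sqrt (real n) * trunc_param n) +
    (s n)\<^sup>2 * (trunc_param n + 2 * s n / sqrt (real n))" for n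
  define rate where "rate n = s n ^ 3 / real n powr (1/4)" for n
  have "(\<lambda>n. main n / rate n) \<longlonglongrightarrow> 0"
    unfolding main_def rate_def s_def trunc_param_def by real_asymp
  then have "\<forall>\<^sub>F n in sequentially. main n / rate n < \<kappa>"
    using order_tendstoD(2) \<open>0 < \<kappa>\<close> by blast
  moreover have "\<forall>\<^sub>F n in sequentially. 1 / real n \<le> s n / sqrt (real n)"
    unfolding s_def by real_asymp
  ultimately show ?thesis
    using trunc_point_bounds trunc_param_small eventually_gt_at_top[of 1]
  proof eventually_elim
    case (elim n)
    show ?case
    proof (intro allI impI)
      fix p :: nat assume p: "\<xi> / 2 * ln (real n) \<le> ln (real p)"
      define \<delta> where "\<delta> = trunc_param n"
      define T where "T = Phi_inv (1 - \<delta>)"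
      define e where "e = c * s n / sqrt (real n) + 1 / real n"
      have "0 < s n" using elim by (simp add: s_def)
      have "0 < \<delta>" using elim by (simp add: \<delta>_def)
      have "0 < rate n" using elim \<open>0 < s n\<close> by (simp add: rate_def)
      have "s n * 1 \<le> s n * c" using \<open>0 < s n\<close> assms by (intro mult_left_mono) auto
      then have "s n / sqrt (real n) \<le> c * s n / sqrt (real n)"
        by (intro divide_right_mono) (auto simp: mult.commute)
      then have "e \<le> 2 * (c * s n / sqrt (real n))"
        using elim(2) unfolding e_def by (simp only: mult_2 add_left_mono order_trans)
      then have e: "e \<le> 2 * c * s n / sqrt (real n)" by simp
      have "0 \<le> e" using \<open>0 < s n\<close> assms unfolding e_def by simp
      have T: "s n / 2 \<le> T" "T \<le> c * s n" "0 < T"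
      proof -
        show "s n / 2 \<le> T" using elim by (simp add: T_def \<delta>_def s_def)
        then show "0 < T" using \<open>0 < s n\<close> by linarith
        have "T \<le> 2 * s n" using elim by (simp add: T_def \<delta>_def s_def)
        also have "\<dots> \<le> c * s n" using assms \<open>0 < s n\<close> by (intro mult_right_mono) auto
        finally show "T \<le> c * s n" .
      qed
      have "error_bound n (c * s n) (c * s n / sqrt (real n)) =
          2 * (T + c * s n) * (e / (T * \<delta>) + 2 * (c * s n) * (\<delta> + e))"
        by (simp add: error_bound_def Let_def T_def \<delta>_def e_def)
      also have "\<dots> \<le> 2 * (2 * (c * s n)) * (e / (s n / 2 * \<delta>) + 2 * (c * s n) * (\<delta> + e))"
      proof (rule mult_mono)
        show "e / (T * \<delta>) + 2 * (c * s n) * (\<delta> + e) \<le> e / (s n / 2 * \<delta>) + 2 * (c * s n) * (\<delta> + e)"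
          using T \<open>0 < s n\<close> \<open>0 < \<delta>\<close> \<open>0 \<le> e\<close> by (intro add_right_mono divide_left_mono mult_right_mono mult_pos_pos) auto
      qed (use T \<open>0 < s n\<close> \<open>0 < \<delta>\<close> \<open>0 \<le> e\<close> assms in auto)
      \<comment> \<open>The factor \<open>s n\<close> from the bound on the scores cancels the
        \<open>s n\<close> that stems from \<open>T\<close> in the denominator.\<close>
      also have "\<dots> = 8 * c * (e / \<delta>) + 8 * c\<^sup>2 * (s n)\<^sup>2 * (\<delta> + e)"
        using \<open>0 < s n\<close> \<open>0 < \<delta>\<close> by (simp add: field_simps power2_eq_square)
      also have "\<dots> \<le> 8 * c * (2 * c * s n / sqrt (real n) / \<delta>) +
          8 * c\<^sup>2 * (s n)\<^sup>2 * (\<delta> + 2 * c * s n / sqrt (real n))"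
        using e \<open>0 < \<delta>\<close> assms by (intro add_mono mult_left_mono divide_right_mono) auto
      also have "\<dots> \<le> 16 * c ^ 3 * main n"
      proof -
        have c: "c\<^sup>2 \<le> c ^ 3" using assms by (intro power_increasing) auto
        have "8 * c * (2 * c * s n / sqrt (real n) / \<delta>) = 16 * c\<^sup>2 * (s n / (sqrt (real n) * \<delta>))"
          by (simp add: power2_eq_square)
        also have "\<dots> \<le> 16 * c ^ 3 * (s n / (sqrt (real n) * \<delta>))"
          using c \<open>0 < s n\<close> \<open>0 < \<delta>\<close> by (intro mult_right_mono) auto
        finally have 1: "8 * c * (2 * c * s n / sqrt (real n) / \<delta>) \<le> \<dots>" .
        have "\<delta> + 2 * c * s n / sqrt (real n) \<le> c * (\<delta> + 2 * s n / sqrt (real n))"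
          using mult_right_mono[of 1 c \<delta>] \<open>0 < \<delta>\<close> assms by (simp add: distrib_left mult_ac)
        then have "8 * c\<^sup>2 * (s n)\<^sup>2 * (\<delta> + 2 * c * s n / sqrt (real n))
            \<le> 8 * c\<^sup>2 * (s n)\<^sup>2 * (c * (\<delta> + 2 * s n / sqrt (real n)))"
          by (intro mult_left_mono) auto
        also have "\<dots> = 8 * c ^ 3 * ((s n)\<^sup>2 * (\<delta> + 2 * s n / sqrt (real n)))"
          by (simp add: power2_eq_square power3_eq_cube)
        also have "\<dots> \<le> 16 * c ^ 3 * ((s n)\<^sup>2 * (\<delta> + 2 * s n / sqrt (real n)))"
          using \<open>0 < s n\<close> \<open>0 < \<delta>\<close> assms by (intro mult_right_mono) auto
        finally show ?thesis using 1 by (simp only: main_def \<delta>_def distrib_left)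
      qed
      also have "\<dots> \<le> 16 * c ^ 3 * (\<kappa> * rate n)"
        using elim(1) \<open>0 < rate n\<close> assms by (intro mult_left_mono) (auto simp: field_simps)
      also have "\<dots> = K * (sqrt (\<xi> / 2) * rate n)"
        using assms by (simp add: \<kappa>_def)
      also have "sqrt (\<xi> / 2) * rate n = sqrt (\<xi> / 2 * ln (real n) * (ln (real n))\<^sup>2 / real n powr (1/2))"
      proof -
        have "ln (real n) = (s n)\<^sup>2" using elim by (simp add: s_def)
        moreover have "real n powr (1/2) = (real n powr (1/4))\<^sup>2"
          using elim by (simp add: power2_eq_square powr_add[symmetric])
        ultimately have "\<xi> / 2 * ln (real n) * (ln (real n))\<^sup>2 / real n powr (1/2) = \<xi> / 2 * (rate n)\<^sup>2"
          by (simp add: rate_def power_divide power_mult[symmetric] power_add[symmetric])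
        then show ?thesis using \<open>0 < rate n\<close> by (simp only: real_sqrt_mult real_sqrt_abs abs_of_pos)
      qed
      also have "K * \<dots> \<le> K * cov_rate n p"
        unfolding cov_rate_def using p assms
        by (intro mult_left_mono real_sqrt_le_mono divide_right_mono mult_right_mono) auto
      finally show "error_bound n (c * sqrt (ln (real n))) (c * sqrt (ln (real n)) / sqrt (real n))
          \<le> K * cov_rate n p"
        by (simp add: s_def)
    qed
  qed
qed

text \<open>The choice of \<open>c\<close> makes every single bad event have probability of order
  \<open>n^(-(\<xi> + 2))\<close>. There are of order \<open>n^\<xi> * n\<close> of them, which
  leaves \<open>1 / n\<close>.\<close>

lemma irregular_mass_bound:
  fixes \<xi> :: real
  assumes "0 < \<xi>"
  defines "c \<equiv> \<xi> + 2"
  shows "\<forall>\<^sub>F n in sequentially. \<forall>p. real p \<le> 2 * real n powr \<xi> \<longrightarrow>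
    real p * (real n * (2 * std_normal_density (c * sqrt (ln (real n))) / (c * sqrt (ln (real n))) +
      2 * exp (- 2 * real n * (c * sqrt (ln (real n)) / sqrt (real n))\<^sup>2))) \<le> 8 / real n"
proof -
  have "\<forall>\<^sub>F n in sequentially. 1 \<le> sqrt (ln (real n))" by real_asymp
  then show ?thesis
    using eventually_gt_at_top[of 1]
  proof eventually_elim
    case (elim n)
    define L where "L = c * sqrt (ln (real n))"
    have "1 * 1 \<le> L" unfolding L_def c_def using elim assms by (intro mult_mono) auto
    then have "1 \<le> L" by simp
    have "0 \<le> ln (real n)" using elim by simp
    have L2: "L\<^sup>2 = c\<^sup>2 * ln (real n)"
      using \<open>0 \<le> ln (real n)\<close> by (simp add: L_def power_mult_distrib)
    \<comment> \<open>Uses \<open>c = \<xi> + 2 \<ge> 2\<close>.\<close>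
    have "\<xi> + 2 \<le> c\<^sup>2 / 2"
      using assms by (simp add: c_def power2_eq_square field_simps)
    then have "(\<xi> + 2) * ln (real n) \<le> L\<^sup>2 / 2"
      using mult_right_mono[of "\<xi> + 2" "c\<^sup>2 / 2", OF _ \<open>0 \<le> ln (real n)\<close>] by (simp add: L2)
    then have "exp (- L\<^sup>2 / 2) \<le> exp (- (\<xi> + 2) * ln (real n))"
      by (subst exp_le_cancel_iff) (simp only: minus_mult_left[symmetric] divide_minus_left neg_le_iff_le)
    also have "\<dots> = real n powr - (\<xi> + 2)" using elim by (simp add: powr_def)
    finally have tail: "exp (- L\<^sup>2 / 2) \<le> real n powr - (\<xi> + 2)" .
    have "std_normal_density L \<le> exp (- L\<^sup>2 / 2)"
      unfolding std_normal_density_def using pi_ge_two by (simp add: field_simps real_le_rsqrt)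
    also note tail
    finally have 1: "std_normal_density L / L \<le> real n powr - (\<xi> + 2)"
      using frac_le[of "std_normal_density L" "std_normal_density L" 1 L] \<open>1 \<le> L\<close> by simp
    have "2 * real n * (L / sqrt (real n))\<^sup>2 = 2 * L\<^sup>2"
      using elim by (simp add: power_divide)
    then have "exp (- 2 * real n * (L / sqrt (real n))\<^sup>2) = exp (- 2 * L\<^sup>2)" by simp
    also have "\<dots> \<le> exp (- L\<^sup>2 / 2)" by simp
    also note tail
    finally have 2: "exp (- 2 * real n * (L / sqrt (real n))\<^sup>2) \<le> real n powr - (\<xi> + 2)" .
    show ?case
    proof (intro allI impI)
      fix p :: nat assume p: "real p \<le> 2 * real n powr \<xi>"
      have "real p * (real n * (2 * (std_normal_density L / L) + 2 * exp (- 2 * real n * (L / sqrt (real n))\<^sup>2)))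
          \<le> (2 * real n powr \<xi>) * (real n * (2 * real n powr - (\<xi> + 2) + 2 * real n powr - (\<xi> + 2)))"
        using p 1 2 \<open>1 \<le> L\<close> by (intro mult_mono mult_left_mono add_mono) auto
      also have "\<dots> = 8 * (real n powr \<xi> * real n powr 1 * real n powr - (\<xi> + 2))"
        using elim by simp
      also have "real n powr \<xi> * real n powr 1 * real n powr - (\<xi> + 2) = real n powr (\<xi> + 1 + - (\<xi> + 2))"
        by (simp only: powr_add)
      also have "\<dots> = 1 / real n" using elim by (simp add: powr_minus_divide)
      finally show "real p * (real n * (2 * std_normal_density (c * sqrt (ln (real n))) / (c * sqrt (ln (real n))) +
          2 * exp (- 2 * real n * (c * sqrt (ln (real n)) / sqrt (real n))\<^sup>2))) \<le> 8 / real n"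
        by (simp add: L_def)
    qed
  qed
qed

text \<open>Rounding \<open>n^\<xi>\<close> to an integer changes it by less than 1. The factor 2
  absorbs this from above, the halved exponent from below.\<close>

lemma dimension_bounds:
  fixes \<xi> :: real and p :: "nat \<Rightarrow> nat"
  assumes "0 < \<xi>" "\<forall>n\<ge>1. \<bar>real (p n) - real n powr \<xi>\<bar> < 1"
  shows "\<forall>\<^sub>F n in sequentially.
    0 < p n \<and> real (p n) \<le> 2 * real n powr \<xi> \<and> \<xi> / 2 * ln (real n) \<le> ln (real (p n))"
proof -
  have "\<forall>\<^sub>F n in sequentially. real n powr (\<xi> / 2) + 1 \<le> real n powr \<xi>"
    using assms(1) by real_asymp
  then show ?thesis
    using eventually_gt_at_top[of 1]
  proof eventually_elim
    case (elim n)
    have p: "real n powr \<xi> - 1 < real (p n)" "real (p n) < real n powr \<xi> + 1"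
      using assms(2)[rule_format, of n] elim by auto
    have "1 \<le> real n powr \<xi>" using elim assms(1) by (simp add: ge_one_powr_ge_zero)
    moreover have "0 < real n powr (\<xi> / 2)" "real n powr (\<xi> / 2) \<le> real (p n)"
      using elim p by auto
    moreover from this have "ln (real n powr (\<xi> / 2)) \<le> ln (real (p n))"
      by (intro ln_mono) auto
    moreover have "ln (real n powr (\<xi> / 2)) = \<xi> / 2 * ln (real n)"
      using elim by (simp add: ln_powr)
    moreover have "0 < real (p n)" "real (p n) \<le> 2 * real n powr \<xi>"
      using calculation(1-3) p by linarith+
    ultimately show ?case by simp
  qed
qed

text \<open>Takes \<open>L = c * sqrt (ln n)\<close> and \<open>\<epsilon> = L / sqrt n\<close>. The
  value \<open>c = \<xi> + 2\<close> is large enough both for the mass of the irregular samples and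
  for the error bound, and the probability is eventually at most \<open>8 / n\<close>.\<close>

lemma tail_probability_tendsto_0:
  fixes \<xi> K :: real and p :: "nat \<Rightarrow> nat"
  assumes "0 < \<xi>" "0 < K"
    and p: "\<forall>n\<ge>1. \<bar>real (p n) - real n powr \<xi>\<bar> < 1"
    and f: "\<And>n j. 1 \<le> n \<Longrightarrow> j < p n \<Longrightarrow> f n j = Phi_inv \<circ> marginal_cdf (P n) j"
    and npn: "\<And>n. 1 \<le> n \<Longrightarrow> nonparanormal (p n) (\<lambda>_. 0) (V n) (f n) (P n)"
    and V: "\<And>n j. 1 \<le> n \<Longrightarrow> j < p n \<Longrightarrow> V n j j = 1"
    and iid: "\<And>n. 1 \<le> n \<Longrightarrow> iid_sample n (p n) (P n) (\<Omega> n) (X n)"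
  shows "(\<lambda>n. measure (\<Omega> n) {\<omega> \<in> space (\<Omega> n).
    max_cov_error n (p n) (\<lambda>i. X n i \<omega>) (f n) > K * cov_rate n (p n)}) \<longlonglongrightarrow> 0"
proof (rule tendsto_sandwich[OF _ _ tendsto_const])
  define c where "c = \<xi> + 2"
  have "2 \<le> c" using assms(1) by (simp add: c_def)
  show "\<forall>\<^sub>F n in sequentially. measure (\<Omega> n) {\<omega> \<in> space (\<Omega> n).
      max_cov_error n (p n) (\<lambda>i. X n i \<omega>) (f n) > K * cov_rate n (p n)} \<le> 8 / real n"
    using dimension_bounds[OF assms(1) p] irregular_mass_bound[OF assms(1), folded c_def]
      error_bound_le_cov_rate[OF assms(1) \<open>2 \<le> c\<close> assms(2)] trunc_param_small eventually_gt_at_top[of 1]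
  proof eventually_elim
    case (elim n)
    have "1 \<le> n" using elim by simp
    have "measure (\<Omega> n) {\<omega> \<in> space (\<Omega> n).
        max_cov_error n (p n) (\<lambda>i. X n i \<omega>) (f n) > K * cov_rate n (p n)}
      \<le> real (p n) * (real n * (2 * std_normal_density (c * sqrt (ln (real n))) / (c * sqrt (ln (real n))) +
        2 * exp (- 2 * real n * (c * sqrt (ln (real n)) / sqrt (real n))\<^sup>2)))"
      by (rule max_cov_error_tail[OF _ _ _ _ _ _ f[OF \<open>1 \<le> n\<close>] npn[OF \<open>1 \<le> n\<close>] V[OF \<open>1 \<le> n\<close>] iid[OF \<open>1 \<le> n\<close>]])
         (use elim \<open>2 \<le> c\<close> in auto)
    also have "\<dots> \<le> 8 / real n" using elim by blast
    finally show ?case .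
  qed
  show "(\<lambda>n. 8 / real n) \<longlonglongrightarrow> 0" by real_asymp
qed simp

lemma max_cov_error_nonneg:
  assumes "0 < p"
  shows "0 \<le> max_cov_error n p x f"
proof -
  let ?err = "\<lambda>j k. \<bar>sample_cov n x (winsor_transform n x) j k - sample_cov n x f j k\<bar>"
  have "finite {?err j k | j k. j < p \<and> k < p}" by (rule finite_image_set2) auto
  then have "?err 0 0 \<le> max_cov_error n p x f"
    unfolding max_cov_error_def using assms by (intro Max_ge) auto
  then show ?thesis using abs_ge_zero order_trans by blast
qed

theorem corollary5p2:
  shows "\<exists>c\<^sub>3>0. \<exists>c\<^sub>4>0.
    \<forall>(\<xi>::real) (p :: nat \<Rightarrow> nat) (P :: nat \<Rightarrow> (nat \<Rightarrow> real) measure)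
      (F :: nat \<Rightarrow> nat \<Rightarrow> real \<Rightarrow> real) (f :: nat \<Rightarrow> nat \<Rightarrow> real \<Rightarrow> real)
      (V :: nat \<Rightarrow> nat \<Rightarrow> nat \<Rightarrow> real)
      (\<Omega> :: nat \<Rightarrow> 'a measure) (X :: nat \<Rightarrow> nat \<Rightarrow> 'a \<Rightarrow> nat \<Rightarrow> real).
      \<xi> > 0 \<longrightarrow>
      (\<forall>n\<ge>1. \<bar>real (p n) - real n powr \<xi>\<bar> < 1) \<longrightarrow>
      (\<forall>n\<ge>1. \<forall>j<p n. F n j = marginal_cdf (P n) j) \<longrightarrow>
      (\<forall>n\<ge>1. \<forall>j<p n. f n j = Phi_inv \<circ> F n j) \<longrightarrow>
      (\<forall>n\<ge>1. nonparanormal (p n) (\<lambda>_. 0) (V n) (f n) (P n)) \<longrightarrow>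
      (\<forall>n\<ge>1. \<forall>j<p n. V n j j = 1) \<longrightarrow>
      (\<forall>n\<ge>1. iid_sample n (p n) (P n) (\<Omega> n) (X n)) \<longrightarrow>
      (\<forall>M > 1 + 1 / \<xi>. \<exists>r :: nat \<Rightarrow> real. r \<in> o(\<lambda>_. 1) \<and>
         (\<forall>n\<ge>1. measure (\<Omega> n) {\<omega> \<in> space (\<Omega> n).
                    max_cov_error n (p n) (\<lambda>i. X n i \<omega>) (f n) > C_const M \<xi> * cov_rate n (p n)}
                  \<le> r n + c\<^sub>3 * exp (- c\<^sub>4 * (C_const M \<xi>)\<^sup>2))) \<and>
      bigo_prob \<Omega> (\<lambda>n \<omega>. max_cov_error n (p n) (\<lambda>i. X n i \<omega>) (f n)) (\<lambda>n. cov_rate n (p n))"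
\<comment> \<open>The constants \<open>c\<^sub>3 = c\<^sub>4 = 1\<close> are arbitrary positive
  numbers: the tail probability itself is \<open>o(1)\<close>.\<close>
proof (rule exI[of _ 1], rule conjI[OF zero_less_one], rule exI[of _ 1], rule conjI[OF zero_less_one],
    intro allI impI)
  fix \<xi> :: real and p :: "nat \<Rightarrow> nat" and P :: "nat \<Rightarrow> (nat \<Rightarrow> real) measure"
    and F :: "nat \<Rightarrow> nat \<Rightarrow> real \<Rightarrow> real" and f :: "nat \<Rightarrow> nat \<Rightarrow> real \<Rightarrow> real"
    and V :: "nat \<Rightarrow> nat \<Rightarrow> nat \<Rightarrow> real" and \<Omega> :: "nat \<Rightarrow> 'a measure"
    and X :: "nat \<Rightarrow> nat \<Rightarrow> 'a \<Rightarrow> nat \<Rightarrow> real"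
  assume \<xi>: "\<xi> > 0"
    and p: "\<forall>n\<ge>1. \<bar>real (p n) - real n powr \<xi>\<bar> < 1"
    and F: "\<forall>n\<ge>1. \<forall>j<p n. F n j = marginal_cdf (P n) j"
    and f: "\<forall>n\<ge>1. \<forall>j<p n. f n j = Phi_inv \<circ> F n j"
    and npn: "\<forall>n\<ge>1. nonparanormal (p n) (\<lambda>_. 0) (V n) (f n) (P n)"
    and V: "\<forall>n\<ge>1. \<forall>j<p n. V n j j = 1"
    and iid: "\<forall>n\<ge>1. iid_sample n (p n) (P n) (\<Omega> n) (X n)"
  define Y where "Y n \<omega> = max_cov_error n (p n) (\<lambda>i. X n i \<omega>) (f n)" for n \<omega>
  define tail where "tail K n = measure (\<Omega> n) {\<omega> \<in> space (\<Omega> n). Y n \<omega> > K * cov_rate n (p n)}" for K n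
  have tail: "tail K \<longlonglongrightarrow> 0" if "0 < K" for K
    unfolding tail_def[abs_def] Y_def
    by (rule tail_probability_tendsto_0[where P = P and V = V, OF \<xi> that])
       (use p F f npn V iid in auto)
  have "\<exists>r. r \<in> o(\<lambda>_. 1) \<and> (\<forall>n\<ge>1. tail (C_const M \<xi>) n \<le> r n + 1 * exp (- 1 * (C_const M \<xi>)\<^sup>2))"
    if "M > 1 + 1 / \<xi>" for M
  proof (intro exI conjI allI impI)
    have "0 < 1 / \<xi>" using \<xi> by simp
    then have "1 < M" using that by linarith
    then have "0 < C_const M \<xi>" using \<xi> by (simp add: C_const_def)
    \<comment> \<open>This fixes \<open>r\<close> as the tail probability. Positivity of
      \<open>C_const M \<xi>\<close>, from \<open>M > 1\<close>, makes the limit applicable.\<close>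
    then show "tail (C_const M \<xi>) \<in> o(\<lambda>_. 1)" using tail by (intro smalloI_tendsto) auto
  qed simp
  moreover have "bigo_prob \<Omega> Y (\<lambda>n. cov_rate n (p n))"
    unfolding bigo_prob_def
  proof (intro allI impI)
    fix \<epsilon> :: real assume "0 < \<epsilon>"
    \<comment> \<open>The bound \<open>K = 1\<close> serves every \<open>\<epsilon>\<close>, as the
      tail tends to 0 for each positive constant.\<close>
    have "\<forall>\<^sub>F n in sequentially. measure (\<Omega> n) {\<omega> \<in> space (\<Omega> n). \<bar>Y n \<omega> / cov_rate n (p n)\<bar> > 1} \<le> \<epsilon>"
      using order_tendstoD(2)[OF tail[OF zero_less_one] \<open>0 < \<epsilon>\<close>] dimension_bounds[OF \<xi> p]
        eventually_gt_at_top[of 1]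
    proof eventually_elim
      case (elim n)
      have "0 < \<xi> / 2 * ln (real n)" using elim \<xi> by simp
      then have "0 < ln (real (p n))" using elim by linarith
      then have "0 < cov_rate n (p n)" unfolding cov_rate_def using elim by simp
      moreover have "0 \<le> Y n \<omega>" for \<omega> unfolding Y_def using elim by (intro max_cov_error_nonneg) simp
      ultimately have "\<bar>Y n \<omega> / cov_rate n (p n)\<bar> > 1 \<longleftrightarrow> Y n \<omega> > 1 * cov_rate n (p n)" for \<omega>
        by simp
      then show ?case using elim by (simp only: tail_def less_imp_le)
    qed
    then show "\<exists>K>0. \<forall>\<^sub>F n in sequentially.
        measure (\<Omega> n) {\<omega> \<in> space (\<Omega> n). \<bar>Y n \<omega> / cov_rate n (p n)\<bar> > K} \<le> \<epsilon>"
      using zero_less_one by blast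
  qed
  ultimately show "(\<forall>M > 1 + 1 / \<xi>. \<exists>r :: nat \<Rightarrow> real. r \<in> o(\<lambda>_. 1) \<and>
      (\<forall>n\<ge>1. measure (\<Omega> n) {\<omega> \<in> space (\<Omega> n).
          max_cov_error n (p n) (\<lambda>i. X n i \<omega>) (f n) > C_const M \<xi> * cov_rate n (p n)}
        \<le> r n + 1 * exp (- 1 * (C_const M \<xi>)\<^sup>2))) \<and>
      bigo_prob \<Omega> (\<lambda>n \<omega>. max_cov_error n (p n) (\<lambda>i. X n i \<omega>) (f n)) (\<lambda>n. cov_rate n (p n))"
    unfolding tail_def Y_def[abs_def] by blast
qed

end
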